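(* Let $M=U\oplus U(r)\oplus N(-r)$, where $r\ge1$ and $N$ is an even positive-definite lattice, and let $\Gamma\subset O^+(M)$ be a finite-index subgroup containing $\exp(e_1\wedge e)$. Then every rank $0$ quasimodular form $f\in\mathsf{QMod}_{k,0}(\Gamma)$ admits a Fourier-Jacobi expansion $$f=\sum_me^{2\pi im\tilde\tau}f_m(\mathfrak z,\tau),$$ where $f_m$ is a (weakly) quasi-Jacobi form of weight $k$ and index $m$ for $N$, with respect to the group $\Gamma\cap\Gamma^J(N,\mathbb R)$.
   Context: Let $e,f$ be the standard basis of $U$ ($\langle e,f\rangle=1$) and $e_1,f_1$ of $U(r)$ ($\langle e_1,f_1\rangle=r$), all isotropic; $(\cdot,\cdot)_N$ is the form of $N$, of rank $l$, with basis $b_i$. For $v,w$, $(v\wedge w)x=\langle w,x\rangle v-\langle v,x\rangle w$. $O^+(M)$ preserves a component $\mathcal D$ of $\{[Z]\in\mathbb P(M_{\mathbb C}):\langle Z,Z\rangle=0,\langle Z,\overline Z\rangle>0\}$. Tube domain: $\mathcal C=\{z=(\tilde\tau,\mathfrak z,\tau)\in\mathbb H\times N_{\mathbb C}\times\mathbb H:2\,\mathrm{Im}\tau\,\mathrm{Im}\tilde\tau-(\mathrm{Im}\mathfrak z,\mathrm{Im}\mathfrak z)_N>0\}$, $z=\tilde\tau e_1+\mathfrak z+\tau f_1$, embedded by $\widetilde\varphi(z)=-\frac12\langle z,z\rangle e+z+f$; $\gamma\widetilde\varphi(z)=J(\gamma,z)\widetilde\varphi(\gamma z)$ defines the action on $\mathcal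 C$ and $J$. Quasimodular forms (rank $0$, weight $k$): $f:\mathcal C\to\mathbb C$ is in $\mathsf{QMod}_{k,0}(\Gamma)$ if there is a smooth $F$ on $\mathcal C$ with $F(\gamma z)=J(\gamma,z)^kF(z)$ for $\gamma\in\Gamma$, which is a polynomial in the functions $\nu_j=\partial_{z_j}\log\langle\mathrm{Im}z,\mathrm{Im}z\rangle$ (linear coordinates $z_j$) with holomorphic coefficients, whose constant term in the $\nu_j$ is $f$. If $\mathrm{rk}\,M\le4$ one also requires that at every $0$-dimensional cusp the constant terms of $F$ and of its derivatives of all orders with respect to the $\nu_j$ have Fourier expansions supported in the closure of the positive cone. Jacobi group: $\Gamma^J(N,\mathbb R)=SL_2(\mathbb R)\ltimes H(N_{\mathbb R})$, $H(N_{\mathbb R})=\{[x,y;\kappa]:x,y\in N_{\mathbb R},\kappa\in\mathbb R\}$ with $[x,y;\kappa][x',y';\kappa']=[x+x',y+y';\kappa+\kappa'+\frac12((x,y')_N-(x',y)_N)]$ and $(A,\zeta)=A\cdot\zeta$, where $(A,[x,y;\kappa])(A',[x',y';\kappa'])=(AA',[(x,y)A';\kappa][x',y';\kappa'])$. It is embedded in $O(M_{\mathbb R})$ by $[x,0;0]\mapsto\exp(\frac1rx\wedge e_1)$, $[0,y;0]\mapsto\exp(y\wedge e)$, $[0,0;\kappa]\mapsto\exp(\kappa e_1\wedge e)$, and $A=\binom{a\ b}{c\ d}$ acting by the matrix $\binom{a\ \ -rb}{-c/r\ \ d}$ on $(e,e_1)$, by $A$ on $(f_1,f)$ and trivially on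 $N$. Its slash action on functions of $(\mathfrak z,\tau)\in N_{\mathbb C}\times\mathbb H$ (with $e(x)=e^{2\pi ix}$): $$(\phi|_{k,m}(A,[x,y;\kappa]))(\mathfrak z,\tau)=(c\tau+d)^{-k}\phi\Big(\tfrac{\mathfrak z+x\tau+y}{c\tau+d},\tfrac{a\tau+b}{c\tau+d}\Big)e\Big(m\big(-\tfrac{c(\mathfrak z+x\tau+y,\mathfrak z+x\tau+y)_N}{2(c\tau+d)}+\tfrac12(x,x)_N\tau+(x,\mathfrak z)_N+\tfrac12(x,y)_N+\kappa\big)\Big).$$ A weakly almost-holomorphic Jacobi form of weight $k$ and index $m$ for a group $G\subset\Gamma^J(N,\mathbb R)$ is a function $\phi$ with $\phi|_{k,m}\gamma=\phi$ for all $\gamma\in G$ which is a polynomial in $1/\mathrm{Im}\tau$ and $\alpha_i=\mathrm{Im}(\mathfrak z_i)/\mathrm{Im}\tau$ with holomorphic coefficients on $N_{\mathbb C}\times\mathbb H$; its coefficient of $\alpha^0(\mathrm{Im}\tau)^0$ is called a weakly quasi-Jacobi form (no cusp condition). *)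

theory Defs
  imports "HOL-Analysis.Analysis" "HOL-Library.Multiset" "HOL-Algebra.Coset"
begin

section \<open>Complexifications\<close>

text \<open>
  The complexification of a real vector space \<open>'v\<close> is \<open>'v \<times> 'v\<close>, a pair \<open>(v, w)\<close> standing
  for \<open>v + i w\<close>. A real-linear map \<open>\<gamma>\<close> extends to it as \<open>map_prod \<gamma> \<gamma>\<close>.
\<close>

type_synonym 'v cx = "'v \<times> 'v"

definition cx_scale :: "complex \<Rightarrow> 'v::real_vector cx \<Rightarrow> 'v cx" where
  "cx_scale c Z = (Re c *\<^sub>R fst Z - Im c *\<^sub>R snd Z, Re c *\<^sub>R snd Z + Im c *\<^sub>R fst Z)"

definition cx_of :: "'v::real_vector \<Rightarrow> 'v cx" where
  "cx_of v = (v, 0)"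

definition cx_conj :: "'v::real_vector cx \<Rightarrow> 'v cx" where
  "cx_conj Z = (fst Z, - snd Z)"

definition cx_bilinear :: "('v \<Rightarrow> 'v \<Rightarrow> real) \<Rightarrow> 'v cx \<Rightarrow> 'v cx \<Rightarrow> complex" where
  "cx_bilinear \<beta> Z W = Complex (\<beta> (fst Z) (fst W) - \<beta> (snd Z) (snd W))
                               (\<beta> (fst Z) (snd W) + \<beta> (snd Z) (fst W))"


section \<open>The lattices\<close>

text \<open>
  The real span of \<open>N\<close> is the type \<open>'a\<close>, with \<open>(\<cdot>,\<cdot>)\<^sub>N\<close> its inner product; \<open>N\<close> is given by a
  finite \<open>\<int>\<close>-basis \<open>B\<close>, so its rank is \<open>card B\<close>. The class \<open>real_inner\<close> rather than
  \<open>euclidean_space\<close> is used because it also admits the zero space, that is, rank \<open>0\<close>.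
\<close>

definition lattice_of :: "'a::real_vector set \<Rightarrow> 'a set" where
  "lattice_of B = {(\<Sum>b\<in>B. of_int (c b) *\<^sub>R b) | c :: 'a \<Rightarrow> int. True}"

definition even_lattice_basis :: "'a::real_inner set \<Rightarrow> bool" where
  "even_lattice_basis B \<longleftrightarrow>
     finite B \<and> independent B \<and> span B = UNIV \<and>
     (\<forall>x\<in>lattice_of B. \<forall>y\<in>lattice_of B. x \<bullet> y \<in> \<int>) \<and>
     (\<forall>x\<in>lattice_of B. \<exists>n::int. x \<bullet> x = 2 * of_int n)"

text \<open>
  The coordinates of \<open>M\<^sub>\<real>\<close> are those with respect to \<open>e\<close>, \<open>e\<^sub>1\<close>, \<open>N\<^sub>\<real>\<close>, \<open>f\<^sub>1\<close>, \<open>f\<close>, in this order.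
\<close>

type_synonym 'a MR = "real \<times> real \<times> 'a \<times> real \<times> real"

definition vec_e :: "'a::real_inner MR" where "vec_e = (1, 0, 0, 0, 0)"
definition vec_e1 :: "'a::real_inner MR" where "vec_e1 = (0, 1, 0, 0, 0)"
definition vec_N :: "'a::real_inner \<Rightarrow> 'a MR" where "vec_N n = (0, 0, n, 0, 0)"
definition vec_f1 :: "'a::real_inner MR" where "vec_f1 = (0, 0, 0, 1, 0)"
definition vec_f :: "'a::real_inner MR" where "vec_f = (0, 0, 0, 0, 1)"

definition bil :: "nat \<Rightarrow> 'a::real_inner MR \<Rightarrow> 'a MR \<Rightarrow> real" where
  "bil r = (\<lambda>(u, u1, n, v1, v) (u', u1', n', v1', v').
     u * v' + v * u' + real r * (u1 * v1' + v1 * u1') - real r * (n \<bullet> n'))"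

definition lattice_M :: "'a::real_inner set \<Rightarrow> 'a MR set" where
  "lattice_M B = {(u, u1, n, v1, v). u \<in> \<int> \<and> u1 \<in> \<int> \<and> n \<in> lattice_of B \<and> v1 \<in> \<int> \<and> v \<in> \<int>}"

definition rank_M :: "'a::real_inner set \<Rightarrow> nat" where
  "rank_M B = card B + 4"

definition wedge :: "nat \<Rightarrow> 'a::real_inner MR \<Rightarrow> 'a MR \<Rightarrow> 'a MR \<Rightarrow> 'a MR" where
  "wedge r v w x = bil r w x *\<^sub>R v - bil r v x *\<^sub>R w"

definition op_exp :: "('v::real_normed_vector \<Rightarrow> 'v) \<Rightarrow> 'v \<Rightarrow> 'v" where
  "op_exp T x = (\<Sum>n. (T ^^ n) x /\<^sub>R fact n)"


section \<open>The tube domain and the orthogonal groups\<close>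

text \<open>A point \<open>z = (\<tau>', \<zz>, \<tau>)\<close> of the tube domain has \<open>\<tau>'\<close> as its \<open>e\<^sub>1\<close>-coordinate.\<close>

type_synonym 'a tube_pt = "complex \<times> 'a cx \<times> complex"

definition tube :: "'a::real_inner tube_pt set" where
  "tube = {(\<tau>', z, \<tau>). Im \<tau>' > 0 \<and> Im \<tau> > 0 \<and> 2 * Im \<tau> * Im \<tau>' - snd z \<bullet> snd z > 0}"

definition tube_scale :: "complex \<Rightarrow> 'a::real_inner tube_pt \<Rightarrow> 'a tube_pt" where
  "tube_scale c = (\<lambda>(\<tau>', z, \<tau>). (c * \<tau>', cx_scale c z, c * \<tau>))"

definition tube_vec :: "'a::real_inner tube_pt \<Rightarrow> 'a MR cx" where
  "tube_vec = (\<lambda>(\<tau>', z, \<tau>).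
     cx_scale \<tau>' (cx_of vec_e1) + map_prod vec_N vec_N z + cx_scale \<tau> (cx_of vec_f1))"

definition tube_embed :: "nat \<Rightarrow> 'a::real_inner tube_pt \<Rightarrow> 'a MR cx" where
  "tube_embed r z =
     cx_scale (- cx_bilinear (bil r) (tube_vec z) (tube_vec z) / 2) (cx_of vec_e)
       + tube_vec z + cx_of vec_f"

text \<open>
  The component \<open>\<D>\<close> is represented by the cone over it in \<open>M\<^sub>\<complex>\<close>. This cone is itself a connected
  component, since \<open>\<complex> - {0}\<close> is connected. It is the one that contains the image of the tube domain,
  the base point below being \<open>\<phi>(i e\<^sub>1 + i f\<^sub>1)\<close>.
\<close>

definition isotropic_positive :: "nat \<Rightarrow> 'a::real_inner MR cx set" where
  "isotropic_positive r =
     {Z. cx_bilinear (bil r) Z Z = 0 \<and> Re (cx_bilinear (bil r) Z (cx_conj Z)) > 0}"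

definition period_cone :: "nat \<Rightarrow> 'a::real_inner MR cx set" where
  "period_cone r =
     connected_component_set (isotropic_positive r) (tube_embed r (\<i>, 0, \<i>))"

definition O_plus_R :: "nat \<Rightarrow> ('a::real_inner MR \<Rightarrow> 'a MR) set" where
  "O_plus_R r = {\<gamma>. linear \<gamma> \<and> bij \<gamma> \<and> (\<forall>x y. bil r (\<gamma> x) (\<gamma> y) = bil r x y) \<and>
                    map_prod \<gamma> \<gamma> ` period_cone r = period_cone r}"

definition O_plus :: "nat \<Rightarrow> 'a::real_inner set \<Rightarrow> ('a MR \<Rightarrow> 'a MR) monoid" where
  "O_plus r B = \<lparr>carrier = {\<gamma> \<in> O_plus_R r. \<gamma> ` lattice_M B = lattice_M B},
                 monoid.mult = (\<circ>), one = id\<rparr>"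

definition finite_index_subgroup :: "'g set \<Rightarrow> 'g monoid \<Rightarrow> bool" where
  "finite_index_subgroup H G \<longleftrightarrow> subgroup H G \<and> finite (rcosets\<^bsub>G\<^esub> H)"

text \<open>
  \<open>J\<close> is the \<open>f\<close>-coordinate of \<open>\<gamma> \<phi>(z)\<close>, and the action divides the remaining coordinates by it
  (the one at \<open>e\<close> is then forced, as the lemma \<open>tube_embed_act\<close> below shows).
\<close>

definition J_factor :: "nat \<Rightarrow> ('a::real_inner MR \<Rightarrow> 'a MR) \<Rightarrow> 'a tube_pt \<Rightarrow> complex" where
  "J_factor r \<gamma> z = (case map_prod \<gamma> \<gamma> (tube_embed r z) of
     ((u, u1, n, v1, v), (u', u1', n', v1', v')) \<Rightarrow> Complex v v')"

definition act :: "nat \<Rightarrow> ('a::real_inner MR \<Rightarrow> 'a MR) \<Rightarrow> 'a tube_pt \<Rightarrow> 'a tube_pt" where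
  "act r \<gamma> z = (case map_prod \<gamma> \<gamma> (tube_embed r z) of
     ((u, u1, n, v1, v), (u', u1', n', v1', v')) \<Rightarrow>
       tube_scale (inverse (J_factor r \<gamma> z)) (Complex u1 u1', (n, n'), Complex v1 v1'))"


section \<open>Smooth and holomorphic functions, polynomials in given functions\<close>

primrec C_k_on :: "nat \<Rightarrow> 'v::real_normed_vector set \<Rightarrow> ('v \<Rightarrow> 'w::real_normed_vector) \<Rightarrow> bool"
where
  "C_k_on 0 S g \<longleftrightarrow> continuous_on S g"
| "C_k_on (Suc k) S g \<longleftrightarrow>
     (\<forall>x\<in>S. g differentiable (at x)) \<and> (\<forall>v. C_k_on k S (\<lambda>x. frechet_derivative g (at x) v))"

definition smooth_on :: "'v::real_normed_vector set \<Rightarrow> ('v \<Rightarrow> 'w::real_normed_vector) \<Rightarrow> bool"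
where
  "smooth_on S g \<longleftrightarrow> (\<forall>k. C_k_on k S g)"

text \<open>
  Holomorphic functions on an open subset \<open>S\<close> of a complex vector space, whose scalar
  multiplication is \<open>sc\<close>: the derivative exists and is complex-linear.
\<close>

definition holo_on ::
  "(complex \<Rightarrow> 'v::real_normed_vector \<Rightarrow> 'v) \<Rightarrow> 'v set \<Rightarrow> ('v \<Rightarrow> complex) \<Rightarrow> bool" where
  "holo_on sc S g \<longleftrightarrow>
     (\<forall>z\<in>S. \<exists>D. (g has_derivative D) (at z) \<and> (\<forall>c v. D (sc c v) = c * D v))"

text \<open>
  \<open>F\<close> is on \<open>S\<close> the polynomial in the functions \<open>\<nu> j\<close>, \<open>j \<in> I\<close>, with holomorphic coefficients
  \<open>c A\<close>. Monomials are indexed by multisets \<open>A\<close> over \<open>I\<close>; the constant term is \<open>c {#}\<close>.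
\<close>

definition poly_expansion ::
  "(complex \<Rightarrow> 'v::real_normed_vector \<Rightarrow> 'v) \<Rightarrow> 'v set \<Rightarrow> 'j set \<Rightarrow> ('j \<Rightarrow> 'v \<Rightarrow> complex) \<Rightarrow>
   ('j multiset \<Rightarrow> 'v \<Rightarrow> complex) \<Rightarrow> ('v \<Rightarrow> complex) \<Rightarrow> bool" where
  "poly_expansion sc S I \<nu> c F \<longleftrightarrow>
     (\<exists>\<A>. finite \<A> \<and> (\<forall>A\<in>\<A>. set_mset A \<subseteq> I \<and> holo_on sc S (c A)) \<and>
           (\<forall>A. A \<notin> \<A> \<longrightarrow> (\<forall>z\<in>S. c A z = 0)) \<and>
           (\<forall>z\<in>S. F z = (\<Sum>A\<in>\<A>. c A z * (\<Prod>j\<in>#A. \<nu> j z))))"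


section \<open>Quasimodular forms of rank 0\<close>

text \<open>The linear coordinates of the tube domain are labelled by the dual basis vectors.\<close>

definition tube_basis :: "'a::real_inner set \<Rightarrow> 'a tube_pt set" where
  "tube_basis B = {(1, 0, 0)} \<union> {(0, cx_of b, 0) | b. b \<in> B} \<union> {(0, 0, 1)}"

text \<open>Wirtinger derivative \<open>\<partial>\<close> in the complex coordinate with coordinate vector \<open>v\<close>.\<close>

definition wirtinger :: "('a::real_inner tube_pt \<Rightarrow> real) \<Rightarrow> 'a tube_pt \<Rightarrow> 'a tube_pt \<Rightarrow> complex"
where
  "wirtinger g v z =
     (of_real (frechet_derivative g (at z) v)
        - \<i> * of_real (frechet_derivative g (at z) (tube_scale \<i> v))) / 2"

definition \<nu>_fun :: "nat \<Rightarrow> 'a::real_inner tube_pt \<Rightarrow> 'a tube_pt \<Rightarrow> complex" where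
  "\<nu>_fun r v = wirtinger (\<lambda>z. ln (bil r (snd (tube_vec z)) (snd (tube_vec z)))) v"

definition positive_cone :: "(real \<times> 'a::real_inner \<times> real) set" where
  "positive_cone = {(s, n, t). s > 0 \<and> t > 0 \<and> 2 * s * t - n \<bullet> n > 0}"

definition e_exp :: "complex \<Rightarrow> complex" where
  "e_exp x = exp (2 * of_real pi * \<i> * x)"

text \<open>
  \<open>g\<close> is on the tube domain a Fourier series \<open>\<Sum> a(n) e(\<langle>n, z\<rangle>)\<close> over vectors \<open>n\<close> in the closure of
  the positive cone of \<open>\<real> e\<^sub>1 + N\<^sub>\<real> + \<real> f\<^sub>1\<close>.
\<close>

definition fourier_positive :: "nat \<Rightarrow> ('a::real_inner tube_pt \<Rightarrow> complex) \<Rightarrow> bool" where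
  "fourier_positive r g \<longleftrightarrow>
     (\<exists>a. \<forall>z\<in>tube. ((\<lambda>(s, n, t).
        a (s, n, t) * e_exp (cx_bilinear (bil r) (cx_of (0, s, n, t, 0)) (tube_vec z)))
        has_sum g z) (closure positive_cone))"

text \<open>
  The \<open>0\<close>-dimensional cusps are the isotropic lines of \<open>M\<^sub>\<real>\<close> spanned by lattice vectors \<open>v\<close>. An
  isometry \<open>g\<close> of \<open>M\<^sub>\<real>\<close> that preserves \<open>\<D>\<close> and sends \<open>e\<close> to \<open>v\<close> identifies the tube domain
  with the tube domain at the cusp \<open>v\<close>, and \<open>F\<close> there becomes \<open>J(g, z)\<^sup>-\<^sup>k F(g z)\<close>. Two choices of
  \<open>g\<close> differ by an isometry of the positive cone and a real translation, which affect neither the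
  \<open>\<nu>\<close>-polynomial shape nor the support condition. If \<open>c A\<close> are the coefficients of the resulting
  polynomial in the \<open>\<nu>\<^sub>j\<close>, then the constant term of its derivative
  \<open>\<Prod>\<^sub>j (\<partial>/\<partial>\<nu>\<^sub>j)\<^bsup>count A j\<^esup>\<close> is \<open>\<Prod>\<^sub>j (count A j)! \<cdot> c A\<close>.
\<close>

definition regular_at_cusps ::
  "nat \<Rightarrow> 'a::real_inner set \<Rightarrow> int \<Rightarrow> ('a tube_pt \<Rightarrow> complex) \<Rightarrow> bool" where
  "regular_at_cusps r B k F \<longleftrightarrow>
     (\<forall>v \<in> lattice_M B. v \<noteq> 0 \<and> bil r v v = 0 \<longrightarrow>
       (\<forall>g \<in> O_plus_R r. g vec_e = v \<longrightarrow>
         (\<exists>c. poly_expansion tube_scale tube (tube_basis B) (\<nu>_fun r) c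
                (\<lambda>z. J_factor r g z powi (- k) * F (act r g z)) \<and>
              (\<forall>A. fourier_positive r
                (\<lambda>z. of_nat (\<Prod>j\<in>set_mset A. fact (count A j)) * c A z)))))"

definition QMod0 ::
  "nat \<Rightarrow> 'a::real_inner set \<Rightarrow> int \<Rightarrow> ('a MR \<Rightarrow> 'a MR) set \<Rightarrow> ('a tube_pt \<Rightarrow> complex) set" where
  "QMod0 r B k \<Gamma> =
     {f. \<exists>F c. smooth_on tube F \<and>
           (\<forall>\<gamma>\<in>\<Gamma>. \<forall>z\<in>tube. F (act r \<gamma> z) = J_factor r \<gamma> z powi k * F z) \<and>
           poly_expansion tube_scale tube (tube_basis B) (\<nu>_fun r) c F \<and>
           (\<forall>z\<in>tube. f z = c {#} z) \<and>
           (rank_M B \<le> 4 \<longrightarrow> regular_at_cusps r B k F)}"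


section \<open>The Jacobi group and quasi-Jacobi forms\<close>

text \<open>
  \<open>(x, y, \<kappa>)\<close> stands for \<open>[x, y; \<kappa>]\<close>, and \<open>((a, b, c, d), x, y, \<kappa>)\<close> for the pair of the matrix with
  rows \<open>(a, b)\<close>, \<open>(c, d)\<close> and \<open>[x, y; \<kappa>]\<close>.
\<close>

type_synonym 'a heis = "'a \<times> 'a \<times> real"
type_synonym 'a jac = "(real \<times> real \<times> real \<times> real) \<times> 'a heis"

definition heis_mult :: "'a::real_inner heis \<Rightarrow> 'a heis \<Rightarrow> 'a heis" where
  "heis_mult = (\<lambda>(x, y, \<kappa>) (x', y', \<kappa>'). (x + x', y + y', \<kappa> + \<kappa>' + (x \<bullet> y' - x' \<bullet> y) / 2))"

definition jacobi_mult :: "'a::real_inner jac \<Rightarrow> 'a jac \<Rightarrow> 'a jac" where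
  "jacobi_mult = (\<lambda>((a, b, c, d), (x, y, \<kappa>)) ((a', b', c', d'), h').
     ((a * a' + b * c', a * b' + b * d', c * a' + d * c', c * b' + d * d'),
      heis_mult (a' *\<^sub>R x + c' *\<^sub>R y, b' *\<^sub>R x + d' *\<^sub>R y, \<kappa>) h'))"

definition jacobi_group :: "'a::real_inner jac monoid" where
  "jacobi_group = \<lparr>carrier = {((a, b, c, d), h). a * d - b * c = 1},
                   monoid.mult = jacobi_mult, one = ((1, 0, 0, 1), (0, 0, 0))\<rparr>"

text \<open>
  Prescribed on the generators \<open>[x,0;0]\<close>, \<open>[0,y;0]\<close>, \<open>[0,0;\<kappa>]\<close>; see the lemma \<open>heis_decomp\<close> below
  for the product decomposition behind the formula.
\<close>

definition heis_embed :: "nat \<Rightarrow> 'a::real_inner heis \<Rightarrow> 'a MR \<Rightarrow> 'a MR" where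
  "heis_embed r = (\<lambda>(x, y, \<kappa>).
     op_exp (\<lambda>u. wedge r (vec_N x) vec_e1 u /\<^sub>R real r) \<circ>
     op_exp (wedge r (vec_N y) vec_e) \<circ>
     op_exp (\<lambda>u. (\<kappa> - x \<bullet> y / 2) *\<^sub>R wedge r vec_e1 vec_e u))"

text \<open>Matrices act on columns of coordinates with respect to \<open>(e, e\<^sub>1)\<close> and \<open>(f\<^sub>1, f)\<close>.\<close>

definition SL2_embed :: "nat \<Rightarrow> real \<times> real \<times> real \<times> real \<Rightarrow> 'a::real_inner MR \<Rightarrow> 'a MR" where
  "SL2_embed r = (\<lambda>(a, b, c, d) (u, u1, n, v1, v).
     (a * u - real r * b * u1, - c / real r * u + d * u1, n, a * v1 + b * v, c * v1 + d * v))"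

definition jacobi_embed :: "nat \<Rightarrow> 'a::real_inner jac \<Rightarrow> 'a MR \<Rightarrow> 'a MR" where
  "jacobi_embed r = (\<lambda>(A, h). SL2_embed r A \<circ> heis_embed r h)"

definition inter_jacobi :: "nat \<Rightarrow> ('a::real_inner MR \<Rightarrow> 'a MR) set \<Rightarrow> 'a jac set" where
  "inter_jacobi r \<Gamma> = {g \<in> carrier jacobi_group. jacobi_embed r g \<in> \<Gamma>}"

definition jacobi_domain :: "('a::real_inner cx \<times> complex) set" where
  "jacobi_domain = {(z, \<tau>). Im \<tau> > 0}"

definition jac_scale :: "complex \<Rightarrow> 'a::real_inner cx \<times> complex \<Rightarrow> 'a cx \<times> complex" where
  "jac_scale c = (\<lambda>(z, \<tau>). (cx_scale c z, c * \<tau>))"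

definition slash ::
  "int \<Rightarrow> int \<Rightarrow> 'a::real_inner jac \<Rightarrow> ('a cx \<times> complex \<Rightarrow> complex) \<Rightarrow> 'a cx \<times> complex \<Rightarrow> complex"
where
  "slash k m = (\<lambda>((a, b, c, d), (x, y, \<kappa>)) \<phi> (z, \<tau>).
     let j = of_real c * \<tau> + of_real d;
         w = z + cx_scale \<tau> (cx_of x) + cx_of y
     in j powi (- k) * \<phi> (cx_scale (inverse j) w, (of_real a * \<tau> + of_real b) / j) *
        e_exp (of_int m *
          (- (of_real c * cx_bilinear (\<bullet>) w w) / (2 * j) + of_real (x \<bullet> x) * \<tau> / 2
           + cx_bilinear (\<bullet>) (cx_of x) z + of_real (x \<bullet> y) / 2 + of_real \<kappa>)))"

text \<open>
  \<open>None\<close> labels the function \<open>1 / Im \<tau>\<close>, and \<open>Some b\<close> the function \<open>\<alpha>\<^sub>b\<close>, with \<open>b\<close> in the basis.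
\<close>

definition jacobi_var :: "'a::real_inner set \<Rightarrow> 'a option \<Rightarrow> 'a cx \<times> complex \<Rightarrow> complex" where
  "jacobi_var B i = (\<lambda>(z, \<tau>). case i of
     None \<Rightarrow> of_real (1 / Im \<tau>)
   | Some b \<Rightarrow> of_real (representation B (snd z) b / Im \<tau>))"

definition weak_almost_holo_jacobi ::
  "'a::real_inner set \<Rightarrow> int \<Rightarrow> int \<Rightarrow> 'a jac set \<Rightarrow>
   ('a option multiset \<Rightarrow> 'a cx \<times> complex \<Rightarrow> complex) \<Rightarrow> ('a cx \<times> complex \<Rightarrow> complex) \<Rightarrow> bool"
where
  "weak_almost_holo_jacobi B k m G c \<phi> \<longleftrightarrow>
     (\<forall>g\<in>G. \<forall>p\<in>jacobi_domain. slash k m g \<phi> p = \<phi> p) \<and>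
     poly_expansion jac_scale jacobi_domain (insert None (Some ` B)) (jacobi_var B) c \<phi>"

definition weak_quasi_jacobi ::
  "'a::real_inner set \<Rightarrow> int \<Rightarrow> int \<Rightarrow> 'a jac set \<Rightarrow> ('a cx \<times> complex \<Rightarrow> complex) \<Rightarrow> bool" where
  "weak_quasi_jacobi B k m G h \<longleftrightarrow>
     (\<exists>\<phi> c. weak_almost_holo_jacobi B k m G c \<phi> \<and> (\<forall>p\<in>jacobi_domain. h p = c {#} p))"


section \<open>Consistency of the explicit formulas\<close>

lemma heis_decomp:
  "(x, y, \<kappa>) = heis_mult (heis_mult (x, 0, 0) (0, y, 0)) (0, 0, \<kappa> - x \<bullet> y / 2)"
  by (simp add: heis_mult_def)

lemma cx_scale_inverse: "j \<noteq> 0 \<Longrightarrow> cx_scale j (cx_scale (inverse j) Z) = Z"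
proof -
  assume "j \<noteq> 0"
  have *: "cx_scale a (cx_scale b Z) = cx_scale (a * b) Z" for a b
    by (simp add: cx_scale_def prod_eq_iff algebra_simps)
  show ?thesis using \<open>j \<noteq> 0\<close> by (subst *) (simp add: cx_scale_def)
qed

lemma cx_bilinear_scale:
  "cx_bilinear (\<bullet>) (cx_scale c Z) (cx_scale d W) = c * d * cx_bilinear (\<bullet>) Z (W::'a::real_inner cx)"
  by (simp add: cx_bilinear_def cx_scale_def complex_eq_iff inner_simps algebra_simps)

lemma tube_embed_eq:
  fixes z :: "'a::real_inner cx"
  assumes "q = real r * (cx_bilinear (\<bullet>) z z / 2 - \<tau>' * \<tau>)"
  shows "tube_embed r (\<tau>', z, \<tau>) =
    ((Re q, Re \<tau>', fst z, Re \<tau>, 1), (Im q, Im \<tau>', snd z, Im \<tau>, 0))"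
  by (simp add: assms tube_embed_def tube_vec_def cx_scale_def cx_of_def vec_e_def vec_e1_def vec_N_def
      vec_f1_def vec_f_def map_prod_def split_beta cx_bilinear_def bil_def inner_commute field_simps)

lemma cx_bilinear_bil:
  fixes n n' :: "'a::real_inner"
  assumes "Z = ((u, u1, n, v1, v), (u', u1', n', v1', v'))"
  shows "cx_bilinear (bil r) Z Z = 2 * Complex u u' * Complex v v'
     + 2 * of_nat r * Complex u1 u1' * Complex v1 v1' - of_nat r * cx_bilinear (\<bullet>) (n, n') (n, n')"
  by (simp add: assms cx_bilinear_def bil_def complex_eq_iff inner_commute algebra_simps)

lemma tube_embed_isotropic: "cx_bilinear (bil r) (tube_embed r z) (tube_embed r z) = 0"
proof -
  obtain \<tau>' w \<tau> where z: "z = (\<tau>', w, \<tau>)" by (cases z) auto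
  show ?thesis unfolding z
    by (subst cx_bilinear_bil[OF tube_embed_eq[OF refl]])
       (simp add: complex_eq_iff cx_bilinear_def field_simps)
qed

lemma tube_embed_act:
  fixes \<gamma> :: "'a::real_inner MR \<Rightarrow> 'a MR"
  assumes \<gamma>: "\<And>x y. bil r (\<gamma> x) (\<gamma> y) = bil r x y" and J: "J_factor r \<gamma> z \<noteq> 0"
  shows "map_prod \<gamma> \<gamma> (tube_embed r z) = cx_scale (J_factor r \<gamma> z) (tube_embed r (act r \<gamma> z))"
proof -
  obtain u u1 n v1 v u' u1' n' v1' v' where
    Z: "map_prod \<gamma> \<gamma> (tube_embed r z) = ((u, u1, n, v1, v), (u', u1', n', v1', v'))"
    by (metis surj_pair)
  define U U1 V1 j N where "U = Complex u u'" and "U1 = Complex u1 u1'" and "V1 = Complex v1 v1'"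
    and "j = Complex v v'" and "N = (n, n')"
  have j: "J_factor r \<gamma> z = j" by (simp add: J_factor_def Z j_def)
  have a: "act r \<gamma> z = (inverse j * U1, cx_scale (inverse j) N, inverse j * V1)"
    by (simp add: act_def Z j tube_scale_def U1_def V1_def N_def)
  have "cx_bilinear (bil r) (map_prod \<gamma> \<gamma> (tube_embed r z)) (map_prod \<gamma> \<gamma> (tube_embed r z)) = 0"
    using tube_embed_isotropic[of r z] by (simp add: cx_bilinear_def \<gamma>)
  then have iso: "2 * U * j + 2 * of_nat r * U1 * V1 - of_nat r * cx_bilinear (\<bullet>) N N = 0"
    by (simp only: cx_bilinear_bil[OF Z] U_def U1_def V1_def j_def N_def)
  define q where "q = real r * (cx_bilinear (\<bullet>) (cx_scale (inverse j) N) (cx_scale (inverse j) N) / 2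
      - (inverse j * U1) * (inverse j * V1))"
  have "j \<noteq> 0" using J j by simp
  have "2 * j * j * q = of_nat r * cx_bilinear (\<bullet>) N N - 2 * of_nat r * U1 * V1"
    using \<open>j \<noteq> 0\<close> by (simp add: q_def cx_bilinear_scale field_simps)
  also have "\<dots> = 2 * j * U" using iso by (simp add: algebra_simps)
  finally have q: "j * q = U" using \<open>j \<noteq> 0\<close> by simp
  have s: "j * (inverse j * w) = w" for w using \<open>j \<noteq> 0\<close> by simp
  have sN: "cx_scale j (cx_scale (inverse j) N) = N" using \<open>j \<noteq> 0\<close> by (rule cx_scale_inverse)
  have re: "Re j * Re w - Im j * Im w = Re (j * w)" "Re j * Im w + Im j * Re w = Im (j * w)" for w
    by simp_all
  have "cx_scale j (tube_embed r (act r \<gamma> z)) =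
    ((Re (j * q), Re (j * (inverse j * U1)), fst (cx_scale j (cx_scale (inverse j) N)),
      Re (j * (inverse j * V1)), Re j),
     (Im (j * q), Im (j * (inverse j * U1)), snd (cx_scale j (cx_scale (inverse j) N)),
      Im (j * (inverse j * V1)), Im j))"
    unfolding a tube_embed_eq[OF q_def] cx_scale_def[of j]
    by (simp only: fst_conv snd_conv scaleR_Pair real_scaleR_def diff_Pair add_Pair re mult_1_right
        mult_zero_right add_0_left diff_zero)
  also have "\<dots> = map_prod \<gamma> \<gamma> (tube_embed r z)"
    unfolding q s sN Z by (simp add: U_def U1_def V1_def j_def N_def)
  finally show ?thesis by (simp add: j)
qed

end

theory Submission
  imports Defs "HOL-Complex_Analysis.Complex_Analysis"
begin

text \<open>
  Write a point of the tube domain as \<open>(\<zeta>, p)\<close> with \<open>p = (\<zz>, \<tau>)\<close>. In terms of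
  \<open>\<epsilon> = Im \<tau> / (2 Im \<tau> Im \<zeta> - (Im \<zz>, Im \<zz>))\<close> the functions \<open>\<nu>\<^sub>j\<close> are affine in \<open>\<epsilon>\<close> with
  coefficients depending on \<open>p\<close> only, and at \<open>\<epsilon> = 0\<close> all of them vanish except
  \<open>\<nu>\<^sub>\<tau> = - i / (2 Im \<tau>)\<close>. The \<open>\<nu>\<^sub>j\<close> are algebraically independent over the holomorphic functions,
  so the translation \<open>\<zeta> \<mapsto> \<zeta> + 1\<close> in \<open>\<Gamma>\<close> makes every holomorphic coefficient of \<open>F\<close> periodic, and
  these coefficients have Fourier expansions in \<open>\<zeta>\<close>. An element of the Jacobi group acts by
  \<open>(\<zeta>, p) \<mapsto> (\<zeta> + s(p), g p)\<close> and preserves \<open>\<epsilon>\<close>. Therefore the \<open>m\<close>-th Fourier coefficient of \<open>F\<close>,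
  a polynomial in \<open>\<epsilon>\<close>, transforms like a Jacobi form of index \<open>m\<close> for each fixed \<open>\<epsilon> > 0\<close>. Letting
  \<open>\<epsilon> \<rightarrow> 0\<close> gives an almost-holomorphic Jacobi form, a polynomial in \<open>1 / Im \<tau>\<close>, whose constant term is
  the \<open>m\<close>-th Fourier coefficient of \<open>f\<close>.
\<close>

section \<open>Fourier series on a half-plane\<close>

lemma e_exp_add: "e_exp (x + y) = e_exp x * e_exp y"
  by (simp add: e_exp_def exp_add[symmetric] algebra_simps)

lemma e_exp_0 [simp]: "e_exp 0 = 1"
  by (simp add: e_exp_def)

lemma e_exp_nonzero [simp]: "e_exp x \<noteq> 0"
  by (simp add: e_exp_def)

lemma e_exp_diff: "e_exp (x - y) = e_exp x / e_exp y"
  by (simp add: e_exp_def exp_diff[symmetric] algebra_simps)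

lemma e_exp_of_int [simp]: "e_exp (of_int n) = 1"
  by (simp add: e_exp_def exp_eq_1 mult.commute)

lemma e_exp_of_neg_int [simp]: "e_exp (- of_int n) = 1"
  using e_exp_of_int[of "- n"] by simp

lemma norm_e_exp: "norm (e_exp x) = exp (- 2 * pi * Im x)"
  by (simp add: e_exp_def norm_exp_eq_Re)

lemma e_exp_eq_iff: "e_exp x = e_exp y \<longleftrightarrow> (\<exists>n::int. x = y + of_int n)"
proof -
  have "2 * complex_of_real pi * \<i> * x = 2 * complex_of_real pi * \<i> * y + of_int (2 * n) * complex_of_real pi * \<i>
      \<longleftrightarrow> 2 * complex_of_real pi * \<i> * x = 2 * complex_of_real pi * \<i> * (y + of_int n)" for n :: int
    by (simp add: algebra_simps)
  also have "\<dots> n \<longleftrightarrow> x = y + of_int n" for n :: int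
    by simp
  finally show ?thesis by (simp add: e_exp_def exp_eq)
qed

lemma e_exp_power: "e_exp x ^ n = e_exp (of_nat n * x)"
  by (simp add: e_exp_def exp_of_nat_mult[symmetric] algebra_simps)

lemma e_exp_has_field_derivative [derivative_intros]:
  "(g has_field_derivative g') (at x within S) \<Longrightarrow>
   ((\<lambda>x. e_exp (g x)) has_field_derivative 2 * of_real pi * \<i> * g' * e_exp (g x)) (at x within S)"
  unfolding e_exp_def by (auto intro!: derivative_eq_intros)

lemma holomorphic_on_e_exp [holomorphic_intros]:
  "g holomorphic_on S \<Longrightarrow> (\<lambda>x. e_exp (g x)) holomorphic_on S"
  unfolding e_exp_def by (intro holomorphic_intros)

lemma continuous_on_e_exp [continuous_intros]:
  "continuous_on S g \<Longrightarrow> continuous_on S (\<lambda>x. e_exp (g x))"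
  unfolding e_exp_def by (intro continuous_intros)

text \<open>The increment of a primitive over a period is constant.\<close>

lemma unit_integral_periodic:
  fixes h :: "complex \<Rightarrow> complex"
  assumes S: "convex S" "open S" and h: "h holomorphic_on S"
    and per: "\<And>\<zeta>. \<zeta> \<in> S \<Longrightarrow> \<zeta> + 1 \<in> S \<Longrightarrow> h (\<zeta> + 1) = h \<zeta>"
    and mem: "\<zeta> \<in> S" "\<zeta> + 1 \<in> S" "\<xi> \<in> S" "\<xi> + 1 \<in> S"
  shows "integral {0..1} (\<lambda>t. h (\<zeta> + of_real t)) = integral {0..1} (\<lambda>t. h (\<xi> + of_real t))"
proof -
  obtain H where H: "\<And>x. x \<in> S \<Longrightarrow> (H has_field_derivative h x) (at x within S)"
    using holomorphic_convex_primitive'[OF S h] by metis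
  have H: "(H has_field_derivative h x) (at x)" if "x \<in> S" for x
    using H[OF that] at_within_open[OF that S(2)] by simp
  \<comment> \<open>\<open>T\<close> collects the left ends of the unit segments contained in
    \<open>S\<close>. As the intersection of \<open>S\<close> with a translate it is convex, so a
    function on it with zero derivative is constant.\<close>
  define T where "T = {x. x \<in> S \<and> x + 1 \<in> S}"
  have T_eq: "T = S \<inter> (+) (-1) ` S"
    by (force simp: T_def image_iff)
  have T: "convex T" "open T"
    unfolding T_eq using S by (simp_all only: convex_Int open_Int open_translation convex_translation)
  have int: "integral {0..1} (\<lambda>t. h (x + of_real t)) = H (x + 1) - H x" if "x \<in> T" for x
  proof -
    have seg: "x + of_real t \<in> S" if t: "t \<in> {0..1}" for t
    proof -
      have "(1 - t) *\<^sub>R x + t *\<^sub>R (x + 1) \<in> S"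
        using \<open>x \<in> T\<close> t S(1) by (intro convexD) (auto simp: T_def)
      also have "(1 - t) *\<^sub>R x + t *\<^sub>R (x + 1) = x + of_real t"
        by (simp add: scaleR_conv_of_real algebra_simps)
      finally show ?thesis .
    qed
    have "((\<lambda>t. h (x + of_real t)) has_integral H (x + of_real 1) - H (x + of_real 0)) {0..1}"
    proof (rule fundamental_theorem_of_calculus)
      fix t :: real assume t: "t \<in> {0..1}"
      have "((\<lambda>w. H (x + w)) has_field_derivative h (x + of_real t)) (at (of_real t))"
        using H[OF seg[OF t]] DERIV_shift[of H _ "of_real t" x] by (simp add: add.commute)
      then show "((\<lambda>t. H (x + of_real t)) has_vector_derivative h (x + of_real t)) (at t within {0..1})"
        by (rule has_vector_derivative_real_field)
    qed simp
    then show ?thesis by (simp add: integral_unique)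
  qed
  have "\<exists>c. \<forall>x\<in>T. H (x + 1) - H x = c"
  proof (rule has_field_derivative_zero_constant[OF T(1)])
    fix x assume x: "x \<in> T"
    have "((\<lambda>x. H (x + 1)) has_field_derivative h x) (at x)"
      using x H[of "x + 1"] per[of x] by (simp add: DERIV_shift T_def)
    then have "((\<lambda>x. H (x + 1) - H x) has_field_derivative h x - h x) (at x)"
      using H[of x] x by (intro derivative_intros) (auto simp: T_def)
    then show "((\<lambda>x. H (x + 1) - H x) has_field_derivative 0) (at x within T)"
      by (simp add: has_field_derivative_at_within)
  qed
  then show ?thesis using mem by (auto simp: int T_def)
qed

text \<open>The majorant \<open>G * \<rho> ^ n\<close> serves twice: the Weierstrass M-test allows
  termwise integration of the geometric series, and the integrated series is absolutely summable,
  which turns \<open>sums\<close> into the unordered \<open>has_sum\<close>.\<close>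

lemma integral_geometric_series:
  fixes g b :: "real \<Rightarrow> complex"
  assumes g: "continuous_on {0..1} g" and b: "continuous_on {0..1} b"
    and \<rho>: "\<And>t. t \<in> {0..1} \<Longrightarrow> norm (b t) \<le> \<rho>" "\<rho> < 1"
  shows "((\<lambda>n. integral {0..1} (\<lambda>t. g t * b t ^ n)) has_sum
      integral {0..1} (\<lambda>t. g t / (1 - b t))) UNIV"
proof -
  have \<rho>0: "0 \<le> \<rho>" using \<rho>(1)[of 0] norm_ge_zero[of "b 0"] by (simp del: norm_ge_zero)
  have "bounded (g ` {0..1})"
    using compact_continuous_image[OF g] compact_imp_bounded by blast
  then obtain G where G: "\<And>t. t \<in> {0..1} \<Longrightarrow> norm (g t) \<le> G"
    unfolding bounded_iff by blast
  have bd: "norm (g t * b t ^ n) \<le> G * \<rho> ^ n" if "t \<in> {0..1}" for t n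
    unfolding norm_mult norm_power
    using G[OF that] \<rho>(1)[OF that] order_trans[OF norm_ge_zero G[OF that]] by (intro mult_mono power_mono) auto
  have sm: "summable (\<lambda>n. G * \<rho> ^ n)" using \<rho>0 \<rho>(2) by simp
  have cont: "continuous_on {0..1} (\<lambda>t. g t * b t ^ n)" for n
    by (intro continuous_intros g b)
  have unif: "uniform_limit {0..1} (\<lambda>n t. \<Sum>i<n. g t * b t ^ i) (\<lambda>t. g t / (1 - b t)) sequentially"
  proof -
    have "uniform_limit {0..1} (\<lambda>n t. \<Sum>i<n. g t * b t ^ i) (\<lambda>t. \<Sum>i. g t * b t ^ i) sequentially"
      by (rule Weierstrass_m_test[OF bd sm])
    moreover have "(\<Sum>i. g t * b t ^ i) = g t / (1 - b t)" if "t \<in> {0..1}" for t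
      using \<rho>(1)[OF that] \<rho>(2) by (subst suminf_mult) (auto simp: suminf_geometric summable_geometric)
    ultimately show ?thesis by (subst (asm) uniform_limit_cong'[OF refl]) auto
  qed
  obtain I J where IJ: "\<And>n. ((\<lambda>t. \<Sum>i<n. g t * b t ^ i) has_integral I n) {0..1}"
    "((\<lambda>t. g t / (1 - b t)) has_integral J) {0..1}" "I \<longlonglongrightarrow> J"
    by (rule uniform_limit_integral[OF unif]) (auto intro!: continuous_on_sum cont)
  have "I = (\<lambda>n. \<Sum>i<n. integral {0..1} (\<lambda>t. g t * b t ^ i))"
  proof
    fix n
    have "I n = integral {0..1} (\<lambda>t. \<Sum>i<n. g t * b t ^ i)" using IJ(1)[of n] by (simp add: integral_unique)
    also have "\<dots> = (\<Sum>i<n. integral {0..1} (\<lambda>t. g t * b t ^ i))"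
      by (intro integral_sum integrable_continuous_real cont) auto
    finally show "I n = (\<Sum>i<n. integral {0..1} (\<lambda>t. g t * b t ^ i))" .
  qed
  with IJ have sums: "(\<lambda>n. integral {0..1} (\<lambda>t. g t * b t ^ n)) sums integral {0..1} (\<lambda>t. g t / (1 - b t))"
    by (simp add: sums_def integral_unique)
  have "norm (integral {0..1} (\<lambda>t. g t * b t ^ n)) \<le> G * \<rho> ^ n" for n
    using integral_bound[OF zero_le_one cont bd] by simp
  then have "summable (\<lambda>n. norm (integral {0..1} (\<lambda>t. g t * b t ^ n)))"
    by (intro summable_comparison_test'[OF sm]) simp
  then show ?thesis by (rule norm_summable_imp_has_sum[OF _ sums])
qed

text \<open>The integrand has an explicit primitive, and this primitive again has period 1.\<close>

lemma integral_e_exp: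
  assumes "n \<noteq> 0"
  shows "integral {0..1} (\<lambda>t. e_exp (of_int n * (\<zeta> + of_real t))) = 0"
proof -
  define E where "E = (\<lambda>w. e_exp (of_int n * (\<zeta> + w)) / (2 * of_real pi * \<i> * of_int n))"
  have d: "(E has_field_derivative e_exp (of_int n * (\<zeta> + w))) (at w)" for w
    unfolding E_def using assms by (auto intro!: derivative_eq_intros)
  have "((\<lambda>t. e_exp (of_int n * (\<zeta> + of_real t))) has_integral E (of_real 1) - E (of_real 0)) {0..1}"
  proof (rule fundamental_theorem_of_calculus)
    fix t :: real
    show "((\<lambda>t. E (of_real t)) has_vector_derivative e_exp (of_int n * (\<zeta> + of_real t))) (at t within {0..1})"
      by (rule has_vector_derivative_real_field[OF d])
  qed simp
  moreover have "E 1 = E 0"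
    using e_exp_of_int[of n] by (simp add: E_def distrib_left e_exp_add)
  ultimately show ?thesis by (simp add: integral_unique)
qed

text \<open>
  Cauchy's formula on the strip modulo \<open>1\<close>: the quotient
  \<open>(h \<zeta> - h w) e(\<zeta>) / (e(\<zeta>) - e(w))\<close> is holomorphic at \<open>\<zeta> = w\<close>, so its integral over a period
  is the same below and above \<open>w\<close>; there the kernel is a geometric series in \<open>e(w - \<zeta>)\<close>,
  respectively in \<open>e(\<zeta> - w)\<close>.
\<close>

lemma fourier_half_plane:
  fixes h :: "complex \<Rightarrow> complex"
  assumes h: "h holomorphic_on {\<zeta>. Im \<zeta> > a}"
    and per: "\<And>\<zeta>. Im \<zeta> > a \<Longrightarrow> h (\<zeta> + 1) = h \<zeta>"
    and \<zeta>0: "Im \<zeta>0 > a" and w: "Im w > a"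
  shows "((\<lambda>m::int. e_exp (of_int m * w) *
      integral {0..1} (\<lambda>t. h (\<zeta>0 + of_real t) * e_exp (- of_int m * (\<zeta>0 + of_real t)))) has_sum h w) UNIV"
proof -
  define C where "C m = integral {0..1} (\<lambda>t. h (\<zeta>0 + of_real t) * e_exp (- of_int m * (\<zeta>0 + of_real t)))" for m :: int
  have H: "convex {\<zeta>. Im \<zeta> > a}" "open {\<zeta>. Im \<zeta> > a}"
    by (simp_all add: convex_halfspace_Im_gt open_halfspace_Im_gt)
  \<comment> \<open>By periodicity the coefficient may be computed at any height above
    \<open>a\<close>. It is needed on one path below \<open>w\<close> and on one above.\<close>
  have C: "C m = integral {0..1} (\<lambda>t. h (\<zeta> + of_real t) * e_exp (- of_int m * (\<zeta> + of_real t)))"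
    if "Im \<zeta> > a" for \<zeta> m
    unfolding C_def
  proof (rule unit_integral_periodic[OF H])
    show "(\<lambda>x. h x * e_exp (- of_int m * x)) holomorphic_on {\<zeta>. Im \<zeta> > a}"
      by (intro holomorphic_intros h)
    show "h (x + 1) * e_exp (- of_int m * (x + 1)) = h x * e_exp (- of_int m * x)" if "x \<in> {\<zeta>. Im \<zeta> > a}" for x
      using per[of x] that e_exp_add[of "- of_int m * x" "of_int (- m)"] by (simp add: distrib_left)
  qed (use that \<zeta>0 in auto)
  have hc: "continuous_on {0..1} (\<lambda>t. h (\<zeta> + of_real t))" if "Im \<zeta> > a" for \<zeta>
    by (rule continuous_on_compose2[OF holomorphic_on_imp_continuous_on[OF h]])
       (use that in \<open>auto intro!: continuous_intros\<close>)
  \<comment> \<open>This open strip of width 2 has room for unit segments centred at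
    \<open>Re w\<close>, but contains no \<open>w + n\<close> with an integer
    \<open>n \<noteq> 0\<close>. Hence \<open>e_exp\<close> takes the value \<open>e_exp w\<close>
    on it at \<open>w\<close> only.\<close>
  define S where "S = {\<zeta>. Im \<zeta> > a} \<inter> ({\<zeta>. Re \<zeta> > Re w - 1} \<inter> {\<zeta>. Re \<zeta> < Re w + 1})"
  have S: "convex S" "open S"
    unfolding S_def
    by (intro convex_Int open_Int H convex_halfspace_Re_gt convex_halfspace_Re_lt open_halfspace_Re_gt open_halfspace_Re_lt)+
  have "w \<in> S" using w by (simp add: S_def)
  then have wS: "w \<in> S" "w \<in> interior S" unfolding interior_open[OF S(2)] by this+
  \<comment> \<open>\<open>P\<close> and \<open>E\<close> are the difference quotients of
    \<open>h\<close> and \<open>e_exp\<close> at \<open>w\<close> with the removable singularity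
    filled in. Since \<open>E\<close> has no zero on \<open>S\<close>, the kernel \<open>K\<close>
    below extends holomorphically across \<open>w\<close>.\<close>
  define P where "P = (\<lambda>z. if z = w then deriv h w else (h z - h w) / (z - w))"
  define E where "E = (\<lambda>z. if z = w then deriv e_exp w else (e_exp z - e_exp w) / (z - w))"
  have P: "P holomorphic_on S"
    unfolding P_def using h wS(2) by (intro pole_lemma) (auto intro: holomorphic_on_subset simp: S_def)
  have E: "E holomorphic_on S"
    unfolding E_def using wS(2) by (intro pole_lemma) (auto intro!: holomorphic_intros)
  have ne: "e_exp z \<noteq> e_exp w" if "z \<in> S" "z \<noteq> w" for z
  proof
    assume "e_exp z = e_exp w"
    then obtain n :: int where n: "z = w + of_int n" by (auto simp: e_exp_eq_iff)
    with that have "n < 1" "n > -1" by (auto simp: S_def)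
    with n that show False by simp
  qed
  have "(e_exp has_field_derivative 2 * of_real pi * \<i> * e_exp w) (at w)"
    using e_exp_has_field_derivative[OF DERIV_ident, of w UNIV] by simp
  then have "deriv e_exp w \<noteq> 0" by (simp add: DERIV_imp_deriv)
  then have E0: "E z \<noteq> 0" if "z \<in> S" for z
    using ne[OF that] by (auto simp: E_def)
  define K where "K = (\<lambda>z. P z * e_exp z / E z)"
  have K: "K holomorphic_on S"
    unfolding K_def by (intro holomorphic_intros P E E0)
  have K_eq: "K z = (h z - h w) * e_exp z / (e_exp z - e_exp w)" if "z \<in> S" "z \<noteq> w" for z
    using ne[OF that] that by (simp add: K_def P_def E_def)
  have K_per: "K (z + 1) = K z" if "z \<in> S" "z + 1 \<in> S" for z
  proof -
    have "z \<noteq> w" "z + 1 \<noteq> w" using that by (auto simp: S_def)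
    moreover have "h (z + 1) = h z" using that per[of z] by (auto simp: S_def)
    ultimately show ?thesis
      using that e_exp_of_int[of 1] by (simp add: K_eq e_exp_add)
  qed
  \<comment> \<open>Heights of two horizontal unit segments centred at \<open>Re w\<close>: one
    between the boundary and \<open>w\<close>, the other above \<open>w\<close>.\<close>
  define y1 where "y1 = (a + Im w) / 2"
  define y2 where "y2 = Im w + 1"
  define \<zeta>1 where "\<zeta>1 = Complex (Re w - 1 / 2) y1"
  define \<zeta>2 where "\<zeta>2 = Complex (Re w - 1 / 2) y2"
  have y: "a < y1" "y1 < Im w" "Im w < y2" using w by (auto simp: y1_def y2_def)
  have im: "Im \<zeta>1 > a" "Im \<zeta>2 > a" using y by (auto simp: \<zeta>1_def \<zeta>2_def)
  have memS: "\<zeta>1 + of_real t \<in> S" "\<zeta>2 + of_real t \<in> S" if "t \<in> {0..1}" for t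
    using that y by (auto simp: \<zeta>1_def \<zeta>2_def S_def)
  have memw: "\<zeta>1 + of_real t \<noteq> w" "\<zeta>2 + of_real t \<noteq> w" for t
    using y by (auto simp: \<zeta>1_def \<zeta>2_def complex_eq_iff)
  have eq: "integral {0..1} (\<lambda>t. K (\<zeta>1 + of_real t)) = integral {0..1} (\<lambda>t. K (\<zeta>2 + of_real t))"
    by (rule unit_integral_periodic[OF S K K_per])
       (use memS[of 0] memS[of 1] in auto)

  \<comment> \<open>The ratios of the two geometric series. On its path each has constant modulus
    less than 1.\<close>
  define b1 where "b1 = (\<lambda>t. e_exp (w - (\<zeta>1 + of_real t)))"
  define b2 where "b2 = (\<lambda>t. e_exp ((\<zeta>2 + of_real t) - w))"
  have nb1: "norm (b1 t) \<le> exp (- 2 * pi * (Im w - y1))" for t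
    by (simp add: b1_def norm_e_exp \<zeta>1_def)
  have nb2: "norm (b2 t) \<le> exp (- 2 * pi * (y2 - Im w))" for t
    by (simp add: b2_def norm_e_exp \<zeta>2_def)
  have lt: "exp (- 2 * pi * (Im w - y1)) < 1" "exp (- 2 * pi * (y2 - Im w)) < 1" using y by auto
  have cb: "continuous_on {0..1} b1" "continuous_on {0..1} b2"
    unfolding b1_def b2_def by (intro continuous_intros)+

  have c1: "integral {0..1} (\<lambda>t. h (\<zeta>1 + of_real t) * b1 t ^ n) = e_exp (of_int (int n) * w) * C (int n)" for n
  proof -
    have "b1 t ^ n = e_exp (of_nat n * w) * e_exp (- of_nat n * (\<zeta>1 + of_real t))" for t
      unfolding b1_def e_exp_power e_exp_add[symmetric] by (simp add: algebra_simps)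
    then show ?thesis by (simp add: C[OF im(1)] mult.left_commute)
  qed
  have s1: "((\<lambda>n. e_exp (of_int (int n) * w) * C (int n)) has_sum
      integral {0..1} (\<lambda>t. h (\<zeta>1 + of_real t) / (1 - b1 t))) UNIV"
    unfolding c1[symmetric] by (rule integral_geometric_series[OF hc[OF im(1)] cb(1) nb1 lt(1)])
  \<comment> \<open>The kernel alone integrates to 1 below \<open>w\<close> and, by
    \<open>k2\<close>, to 0 above. This difference is what isolates \<open>h w\<close>.\<close>
  have k1: "integral {0..1} (\<lambda>t. 1 / (1 - b1 t)) = 1"
  proof -
    have "((\<lambda>n. integral {0..1} (\<lambda>t. 1 * b1 t ^ n)) has_sum integral {0..1} (\<lambda>t. 1 / (1 - b1 t))) UNIV"
      by (rule integral_geometric_series[OF _ cb(1) nb1 lt(1)]) auto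
    moreover have "integral {0..1} (\<lambda>t. 1 * b1 t ^ n) = (if n = 0 then 1 else 0)" for n
    proof -
      have "b1 t ^ n = e_exp (of_nat n * w) * e_exp (of_int (- int n) * (\<zeta>1 + of_real t))" for t
        unfolding b1_def e_exp_power e_exp_add[symmetric] by (simp add: algebra_simps)
      then show ?thesis using integral_e_exp[of "- int n" \<zeta>1] by simp
    qed
    ultimately have "((\<lambda>n::nat. if n = 0 then 1 else (0::complex)) has_sum integral {0..1} (\<lambda>t. 1 / (1 - b1 t))) UNIV"
      by simp
    moreover have "((\<lambda>n::nat. if n = 0 then 1 else (0::complex)) has_sum 1) UNIV"
      by (rule has_sum_finite_neutralI[of "{0}"]) auto
    ultimately show ?thesis using has_sum_unique by blast
  qed
  have int1: "integral {0..1} (\<lambda>t. K (\<zeta>1 + of_real t)) = integral {0..1} (\<lambda>t. h (\<zeta>1 + of_real t) / (1 - b1 t)) - h w"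
  proof -
    have b1ne: "1 - b1 t \<noteq> 0" for t using nb1[of t] lt(1) by auto
    have "integral {0..1} (\<lambda>t. K (\<zeta>1 + of_real t)) =
        integral {0..1} (\<lambda>t. h (\<zeta>1 + of_real t) / (1 - b1 t) - h w * (1 / (1 - b1 t)))"
    proof (rule integral_cong)
      fix t :: real assume t: "t \<in> {0..1}"
      show "K (\<zeta>1 + of_real t) = h (\<zeta>1 + of_real t) / (1 - b1 t) - h w * (1 / (1 - b1 t))"
      proof -
        have "1 / (1 - b1 t) = e_exp (\<zeta>1 + of_real t) / (e_exp (\<zeta>1 + of_real t) - e_exp w)"
          using ne[OF memS(1)[OF t] memw(1)] b1ne[of t] by (simp add: b1_def e_exp_diff field_simps)
        then have q: "x / (1 - b1 t) = x * e_exp (\<zeta>1 + of_real t) / (e_exp (\<zeta>1 + of_real t) - e_exp w)" for x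
          by (metis times_divide_eq_right mult_1_right)
        show ?thesis
          unfolding K_eq[OF memS(1)[OF t] memw(1)] q by (simp add: left_diff_distrib diff_divide_distrib)
      qed
    qed
    also have "\<dots> = integral {0..1} (\<lambda>t. h (\<zeta>1 + of_real t) / (1 - b1 t)) - integral {0..1} (\<lambda>t. h w * (1 / (1 - b1 t)))"
      by (rule integral_diff)
         (use b1ne hc[OF im(1)] cb in \<open>auto intro!: integrable_continuous_real continuous_intros\<close>)
    finally show ?thesis by (simp only: integral_mult_right k1 mult_1_right)
  qed
  \<comment> \<open>The additional factor \<open>b2 t\<close> makes this series start at exponent 1:
    it supplies the indices -1, -2, and so on, while index 0 belongs to the lower path.\<close>
  have c2: "integral {0..1} (\<lambda>t. (h (\<zeta>2 + of_real t) * b2 t) * b2 t ^ n) = e_exp (of_int (- int (Suc n)) * w) * C (- int (Suc n))" for n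
  proof -
    have "b2 t * b2 t ^ n = e_exp (of_int (- int (Suc n)) * w) * e_exp (- of_int (- int (Suc n)) * (\<zeta>2 + of_real t))" for t
      unfolding power_Suc[symmetric] unfolding b2_def e_exp_power e_exp_add[symmetric] by (simp add: algebra_simps)
    then show ?thesis
      unfolding mult.assoc C[OF im(2)] integral_mult_right[symmetric] by (simp only: mult.left_commute)
  qed
  have s2: "((\<lambda>n. e_exp (of_int (- int (Suc n)) * w) * C (- int (Suc n))) has_sum
      integral {0..1} (\<lambda>t. (h (\<zeta>2 + of_real t) * b2 t) / (1 - b2 t))) UNIV"
    unfolding c2[symmetric] using hc[OF im(2)] cb(2)
    by (intro integral_geometric_series[OF _ cb(2) nb2 lt(2)] continuous_intros)
  have k2: "integral {0..1} (\<lambda>t. b2 t / (1 - b2 t)) = 0"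
  proof -
    have "((\<lambda>n. integral {0..1} (\<lambda>t. b2 t * b2 t ^ n)) has_sum integral {0..1} (\<lambda>t. b2 t / (1 - b2 t))) UNIV"
      by (rule integral_geometric_series[OF cb(2) cb(2) nb2 lt(2)])
    moreover have "integral {0..1} (\<lambda>t. b2 t * b2 t ^ n) = 0" for n
    proof -
      have "b2 t * b2 t ^ n = e_exp (of_int (- int (Suc n)) * w) * e_exp (of_int (int (Suc n)) * (\<zeta>2 + of_real t))" for t
        unfolding power_Suc[symmetric] unfolding b2_def e_exp_power e_exp_add[symmetric] by (simp add: algebra_simps)
      then show ?thesis using integral_e_exp[of "int (Suc n)" \<zeta>2] by (simp only: integral_mult_right) simp
    qed
    ultimately show ?thesis by (metis (no_types, lifting) has_sum_0 has_sum_unique)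
  qed
  have int2: "integral {0..1} (\<lambda>t. K (\<zeta>2 + of_real t)) = - integral {0..1} (\<lambda>t. (h (\<zeta>2 + of_real t) * b2 t) / (1 - b2 t))"
  proof -
    have b2ne: "1 - b2 t \<noteq> 0" for t using nb2[of t] lt(2) by auto
    have "integral {0..1} (\<lambda>t. K (\<zeta>2 + of_real t)) =
        integral {0..1} (\<lambda>t. h w * (b2 t / (1 - b2 t)) - (h (\<zeta>2 + of_real t) * b2 t) / (1 - b2 t))"
    proof (rule integral_cong)
      fix t :: real assume t: "t \<in> {0..1}"
      show "K (\<zeta>2 + of_real t) = h w * (b2 t / (1 - b2 t)) - (h (\<zeta>2 + of_real t) * b2 t) / (1 - b2 t)"
      proof -
        have "b2 t / (1 - b2 t) = - (e_exp (\<zeta>2 + of_real t) / (e_exp (\<zeta>2 + of_real t) - e_exp w))"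
          using ne[OF memS(2)[OF t] memw(2)] b2ne[of t] by (simp add: b2_def e_exp_diff field_simps)
        then have q: "x * b2 t / (1 - b2 t) = - (x * e_exp (\<zeta>2 + of_real t) / (e_exp (\<zeta>2 + of_real t) - e_exp w))" for x
          by (metis times_divide_eq_right mult_minus_right)
        show ?thesis
          unfolding K_eq[OF memS(2)[OF t] memw(2)] times_divide_eq_right q
          by (simp add: left_diff_distrib diff_divide_distrib)
      qed
    qed
    also have "\<dots> = integral {0..1} (\<lambda>t. h w * (b2 t / (1 - b2 t))) - integral {0..1} (\<lambda>t. (h (\<zeta>2 + of_real t) * b2 t) / (1 - b2 t))"
      by (rule integral_diff)
         (use b2ne hc[OF im(2)] cb in \<open>auto intro!: integrable_continuous_real continuous_intros\<close>)
    finally show ?thesis by (simp only: integral_mult_right k2 mult_zero_right diff_0)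
  qed
  define I1 where "I1 = integral {0..1} (\<lambda>t. h (\<zeta>1 + of_real t) / (1 - b1 t))"
  define I2 where "I2 = integral {0..1} (\<lambda>t. (h (\<zeta>2 + of_real t) * b2 t) / (1 - b2 t))"
  \<comment> \<open>The equality \<open>eq\<close> of the two period integrals now reads
    \<open>I1 - h w = - I2\<close>.\<close>
  have tot: "I1 + I2 = h w" using eq int1 int2 by (simp add: I1_def I2_def algebra_simps)
  have u1: "((\<lambda>m. e_exp (of_int m * w) * C m) has_sum I1) (range int)"
    using s1 by (subst has_sum_reindex) (auto simp: o_def I1_def)
  have u2: "((\<lambda>m. e_exp (of_int m * w) * C m) has_sum I2) (range (\<lambda>n. - int (Suc n)))"
    using s2 by (subst has_sum_reindex) (auto simp: o_def I2_def inj_on_def)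
  have "((\<lambda>m. e_exp (of_int m * w) * C m) has_sum (I1 + I2)) (range int \<union> range (\<lambda>n. - int (Suc n)))"
    by (rule has_sum_Un_disjoint[OF u1 u2]) auto
  also have "m \<in> range int \<union> range (\<lambda>n. - int (Suc n))" for m
    by (cases m rule: int_cases) auto
  then have "range int \<union> range (\<lambda>n. - int (Suc n)) = UNIV" by blast
  finally show ?thesis by (simp add: tot C_def)
qed


section \<open>Integrals of holomorphic functions\<close>

text \<open>Taylor's formula on the unit disc, with the second derivative bounded by Cauchy's
  inequality on circles of radius \<open>R / 4\<close>. These stay inside \<open>ball 0 R\<close>
  because \<open>R \<ge> 2\<close>, and \<open>2 / (1 / 4)\<^sup>2 = 32\<close> gives the
  constant.\<close>

lemma second_order_remainder:
  fixes h :: "complex \<Rightarrow> complex"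
  assumes h: "h holomorphic_on ball 0 R" and R: "R \<ge> 2"
    and K: "\<And>z. z \<in> ball 0 R \<Longrightarrow> norm (h z) \<le> K"
    and d: "(h has_field_derivative d) (at 0)"
  shows "norm (h 1 - h 0 - d) \<le> 32 * K / R\<^sup>2"
proof -
  have sub: "cball z (R / 4) \<subseteq> ball 0 R" if "z \<in> cball 0 1" for z :: complex
  proof
    fix w assume "w \<in> cball z (R / 4)"
    then have "norm w \<le> norm z + R / 4"
      using norm_triangle_sub[of w z] by (simp add: dist_norm norm_minus_commute)
    then show "w \<in> ball 0 R" using that R by simp
  qed
  have bd: "norm ((deriv ^^ 2) h z) \<le> 32 * K / R\<^sup>2" if z: "z \<in> cball 0 1" for z
  proof -
    have "norm ((deriv ^^ 2) h z) \<le> fact 2 * K / (R / 4) ^ 2"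
    proof (rule Cauchy_inequality)
      show "h holomorphic_on ball z (R / 4)" using h sub[OF z] ball_subset_cball by (blast intro: holomorphic_on_subset)
      show "continuous_on (cball z (R / 4)) h"
        using h sub[OF z] by (blast intro: holomorphic_on_imp_continuous_on holomorphic_on_subset)
      show "norm (h x) \<le> K" if "norm (z - x) = R / 4" for x
        using K[of x] sub[OF z] that by (auto simp: dist_norm)
    qed (use R in auto)
    then show ?thesis by (simp add: power_divide)
  qed
  have "norm ((deriv ^^ 0) h 1 - (\<Sum>i\<le>1. (deriv ^^ i) h 0 * (1 - 0) ^ i / fact i)) \<le> 32 * K / R\<^sup>2 * norm (1 - 0 :: complex) ^ Suc 1 / fact 1"
  proof (rule complex_Taylor[where S = "cball 0 1" and f = "\<lambda>i. (deriv ^^ i) h" and n = 1 and w = 0 and z = 1])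
    show "((deriv ^^ i) h has_field_derivative (deriv ^^ Suc i) h x) (at x within cball 0 1)" if "x \<in> cball 0 1" for i x
      by (rule has_field_derivative_at_within[OF has_field_derivative_higher_deriv[OF h open_ball]]) (use that R in auto)
    show "norm ((deriv ^^ Suc 1) h x) \<le> 32 * K / R\<^sup>2" if "x \<in> cball 0 1" for x
      using bd[OF that] by (simp add: numeral_2_eq_2)
  qed auto
  then show ?thesis using DERIV_imp_deriv[OF d] by (simp add: algebra_simps)
qed

text \<open>Cauchy's inequality on the circle of radius \<open>R / 2\<close>, since \<open>h\<close>
  is controlled on the open ball only.\<close>

lemma derivative_bound:
  fixes h :: "complex \<Rightarrow> complex"
  assumes h: "h holomorphic_on ball 0 R" and R: "R > 0"
    and K: "\<And>z. z \<in> ball 0 R \<Longrightarrow> norm (h z) \<le> K"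
    and d: "(h has_field_derivative d) (at 0)"
  shows "norm d \<le> 2 * K / R"
proof -
  have sub: "cball 0 (R / 2) \<subseteq> ball (0::complex) R" using R by auto
  have "norm ((deriv ^^ 1) h 0) \<le> fact 1 * K / (R / 2) ^ 1"
  proof (rule Cauchy_inequality)
    show "h holomorphic_on ball 0 (R / 2)" using h sub ball_subset_cball by (blast intro: holomorphic_on_subset)
    show "continuous_on (cball 0 (R / 2)) h"
      using h sub by (blast intro: holomorphic_on_imp_continuous_on holomorphic_on_subset)
    show "norm (h x) \<le> K" if "norm (0 - x) = R / 2" for x
      using K[of x] R that by auto
  qed (use R in auto)
  then show ?thesis using DERIV_imp_deriv[OF d] by (simp add: mult.commute)
qed

section \<open>Holomorphic functions restricted to complex lines\<close>

lemma has_field_derivative_along_line: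
  assumes g: "(g has_derivative D) (at (p + sc w v))" and D: "\<And>c v. D (sc c v) = c * D v"
    and sc: "bounded_linear (\<lambda>c. sc c v)"
  shows "((\<lambda>z. g (p + sc z v)) has_field_derivative D v) (at w)"
proof -
  have "((\<lambda>z. p + sc z v) has_derivative (\<lambda>c. sc c v)) (at w)"
    using bounded_linear_imp_has_derivative[OF sc] by (auto intro!: derivative_eq_intros)
  from has_derivative_compose[OF this g] show ?thesis
    by (simp add: has_field_derivative_def D mult_commute_abs)
qed

text \<open>Reduces several variables to one, where Cauchy's estimates and the identity theorem
  apply. The abstract \<open>sc\<close> covers both \<open>jac_scale\<close> and
  \<open>tube_scale\<close>.\<close>

lemma holo_on_line_holomorphic:
  assumes g: "holo_on sc S g" and sc: "bounded_linear (\<lambda>c. sc c v)"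
    and mem: "\<And>z. z \<in> T \<Longrightarrow> p + sc z v \<in> S"
  shows "(\<lambda>z. g (p + sc z v)) holomorphic_on T"
proof -
  have "\<exists>d. ((\<lambda>z. g (p + sc z v)) has_field_derivative d) (at z)" if z: "z \<in> T" for z
  proof -
    obtain D where "(g has_derivative D) (at (p + sc z v))" "\<And>c v. D (sc c v) = c * D v"
      using g mem[OF z] unfolding holo_on_def by blast
    from has_field_derivative_along_line[of g D p sc z v, OF this sc] show ?thesis by blast
  qed
  then show ?thesis
    unfolding holomorphic_on_def field_differentiable_def by (blast intro: has_field_derivative_at_within)
qed

lemma holo_on_imp_continuous_on: "holo_on sc S g \<Longrightarrow> continuous_on S g"
  unfolding holo_on_def
  by (meson continuous_at_imp_continuous_on has_derivative_continuous)

lemma holo_on_cong: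
  assumes "holo_on sc S g" "open S" "\<And>z. z \<in> S \<Longrightarrow> g z = h z"
  shows "holo_on sc S h"
  using assms unfolding holo_on_def by (metis has_derivative_transform_within_open)

lemma norm_cx_scale: "norm (cx_scale c (v :: 'a::real_inner cx)) = norm c * norm v"
proof -
  have "(norm (cx_scale c v))\<^sup>2 = (norm c * norm v)\<^sup>2"
    unfolding power_mult_distrib cmod_power2 power2_norm_eq_inner
    by (simp add: cx_scale_def inner_prod_def inner_simps power2_eq_square inner_commute algebra_simps)
  then show ?thesis by (simp add: power2_eq_iff_nonneg)
qed

lemma norm_jac_scale: "norm (jac_scale c v) = norm c * norm v"
proof -
  obtain z \<tau> where v: "v = (z, \<tau>)" by (cases v)
  have "(norm (jac_scale c v))\<^sup>2 = (norm c * norm v)\<^sup>2"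
    by (simp add: v jac_scale_def norm_Pair norm_cx_scale norm_mult power_mult_distrib distrib_left)
  then show ?thesis by (simp add: power2_eq_iff_nonneg)
qed

lemma bounded_linear_cx_scale: "bounded_linear (\<lambda>c. cx_scale c (v :: 'a::real_inner cx))"
  by (rule bounded_linear_intro[where K = "norm v"])
     (auto simp: norm_cx_scale, auto simp: cx_scale_def prod_eq_iff algebra_simps)

lemma bounded_linear_jac_scale: "bounded_linear (\<lambda>c. jac_scale c v)"
  unfolding jac_scale_def case_prod_unfold
  by (intro bounded_linear_Pair bounded_linear_cx_scale bounded_linear_mult_left)

lemma bounded_linear_tube_scale: "bounded_linear (\<lambda>c. tube_scale c v)"
  unfolding tube_scale_def case_prod_unfold
  by (intro bounded_linear_Pair bounded_linear_cx_scale bounded_linear_mult_left)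

lemma jac_scale_0 [simp]: "jac_scale 0 v = 0"
  by (simp add: jac_scale_def cx_scale_def case_prod_unfold zero_prod_def)

lemma jac_scale_1 [simp]: "jac_scale 1 v = v"
  by (simp add: jac_scale_def cx_scale_def case_prod_unfold)

text \<open>
  No continuity of the derivative is assumed: Cauchy's estimates on complex lines bound the
  second-order remainder of \<open>g p t\<close> uniformly in \<open>t\<close>.
\<close>

lemma holo_on_integral:
  fixes g :: "'a::real_inner cx \<times> complex \<Rightarrow> real \<Rightarrow> complex"
  assumes U: "open U" and holo: "\<And>t. holo_on jac_scale U (\<lambda>p. g p t)"
    and cont: "continuous_on (U \<times> UNIV) (\<lambda>(p, t). g p t)"
  shows "holo_on jac_scale U (\<lambda>p. integral {0..1} (g p))"
  unfolding holo_on_def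
proof
  fix p assume p: "p \<in> U"
  have "\<forall>t. \<exists>D. ((\<lambda>p. g p t) has_derivative D) (at p) \<and> (\<forall>c v. D (jac_scale c v) = c * D v)"
    using holo p unfolding holo_on_def by blast
  then obtain D where D: "\<And>t. ((\<lambda>p. g p t) has_derivative D t) (at p)"
    and Dsc: "\<And>t c v. D t (jac_scale c v) = c * D t v" by metis
  have gc: "continuous_on {0..1} (g q)" if "q \<in> U" for q
  proof -
    have "continuous_on {0..1} (\<lambda>t. (\<lambda>(p, t). g p t) (q, t))"
      by (rule continuous_on_compose2[OF cont]) (use that in \<open>auto intro!: continuous_intros\<close>)
    then show ?thesis by simp
  qed
  have "bounded (g p ` {0..1})"
    using compact_continuous_image[OF gc[OF p]] compact_imp_bounded by blast
  then obtain K0 where K0: "\<And>t. t \<in> {0..1} \<Longrightarrow> norm (g p t) \<le> K0"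
    unfolding bounded_iff by blast
  define K where "K = \<bar>K0\<bar> + 1"
  have "K > 0" by (simp add: K_def)
  define W where "W = (\<lambda>(p, t). g p t) -` ball 0 K \<inter> (U \<times> UNIV)"
  have "open W" unfolding W_def
    using continuous_open_preimage[OF cont open_Times[OF U open_UNIV] open_ball, of 0 K] by (simp add: Int_commute)
  moreover have "{p} \<times> {0..1} \<subseteq> W" using K0 p by (fastforce simp: W_def K_def)
  \<comment> \<open>Compactness of the unit interval makes the bound \<open>K\<close> valid on a
    neighbourhood of \<open>p\<close> that does not depend on \<open>t\<close>.\<close>
  ultimately obtain X where X: "p \<in> X" "open X" "X \<times> {0..1} \<subseteq> W"
    using Elementary_Topology.tube_lemma[of "{0..1::real}" W p] by auto
  then obtain \<rho> where \<rho>: "\<rho> > 0" "ball p \<rho> \<subseteq> X" by (meson open_contains_ball)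
  have near: "q \<in> U" "norm (g q t) \<le> K" if "norm (q - p) < \<rho>" "t \<in> {0..1}" for q t
  proof -
    have "q \<in> ball p \<rho>" using that by (simp add: dist_norm norm_minus_commute)
    then have "(q, t) \<in> W" using X \<rho> that(2) by blast
    then show "q \<in> U" "norm (g q t) \<le> K" by (auto simp: W_def)
  qed
  \<comment> \<open>Since \<open>jac_scale\<close> is multiplicative for the norm, this radius is
    exactly what keeps \<open>p + jac_scale z v\<close> within distance \<open>\<rho>\<close> of
    \<open>p\<close>.\<close>
  have line: "(\<lambda>z. g (p + jac_scale z v) t) holomorphic_on ball 0 (\<rho> / norm v)"
    "((\<lambda>z. g (p + jac_scale z v) t) has_field_derivative D t v) (at 0)"
    "\<And>z. z \<in> ball 0 (\<rho> / norm v) \<Longrightarrow> norm (g (p + jac_scale z v) t) \<le> K"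
    if "v \<noteq> 0" "t \<in> {0..1}" for v t
  proof -
    have *: "norm (jac_scale z v) < \<rho>" if "z \<in> ball 0 (\<rho> / norm v)" for z
      using that \<open>v \<noteq> 0\<close> by (simp add: norm_jac_scale field_simps)
    show "(\<lambda>z. g (p + jac_scale z v) t) holomorphic_on ball 0 (\<rho> / norm v)"
      using * near(1)[OF _ that(2)]
      by (intro holo_on_line_holomorphic[where g = "\<lambda>p. g p t", OF holo bounded_linear_jac_scale]) auto
    show "((\<lambda>z. g (p + jac_scale z v) t) has_field_derivative D t v) (at 0)"
      using D[of t] Dsc
      by (intro has_field_derivative_along_line[where g = "\<lambda>p. g p t", OF _ _ bounded_linear_jac_scale]) auto
    show "norm (g (p + jac_scale z v) t) \<le> K" if "z \<in> ball 0 (\<rho> / norm v)" for z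
      using *[OF that] near(2)[of "p + jac_scale z v"] \<open>t \<in> {0..1}\<close> by simp
  qed
  \<comment> \<open>The bound \<open>norm v \<le> \<rho> / 2\<close> makes the disc on the line have
    radius at least 2, as \<open>second_order_remainder\<close> requires; the point
    \<open>p + v\<close> is its parameter 1.\<close>
  have rem: "norm (g (p + v) t - g p t - D t v) \<le> 32 * K / \<rho>\<^sup>2 * (norm v)\<^sup>2"
    if "norm v \<le> \<rho> / 2" "t \<in> {0..1}" for v t
  proof (cases "v = 0")
    case True then show ?thesis using D[of t] by (simp add: linear_0 has_derivative_linear)
  next
    case False
    have "norm (g (p + jac_scale 1 v) t - g (p + jac_scale 0 v) t - D t v) \<le> 32 * K / (\<rho> / norm v)\<^sup>2"
      by (rule second_order_remainder[OF line(1)[OF False that(2)] _ line(3)[OF False that(2)] line(2)[OF False that(2)]])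
         (use that False in \<open>auto simp: field_simps\<close>)
    then show ?thesis by (simp add: power_divide)
  qed
  have Dbd: "norm (D t v) \<le> 2 * K / \<rho> * norm v" if "t \<in> {0..1}" for v t
  proof (cases "v = 0")
    case True then show ?thesis using D[of t] by (simp add: linear_0 has_derivative_linear)
  next
    case False
    have "norm (D t v) \<le> 2 * K / (\<rho> / norm v)"
      by (rule derivative_bound[OF line(1)[OF False that] _ line(3)[OF False that] line(2)[OF False that]])
         (use \<rho> False in auto)
    then show ?thesis by simp
  qed
  \<comment> \<open>\<open>D t v\<close> is the limit of the difference quotients with step
    \<open>1 / n\<close>, which are continuous in \<open>t\<close>. By \<open>rem\<close> their
    error is of order \<open>1 / n\<close> uniformly in \<open>t\<close>.\<close>
  have Dc: "continuous_on {0..1} (\<lambda>t. D t v)" for v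
  proof -
    define F where "F = (\<lambda>n::nat. \<lambda>t. of_nat n * (g (p + (1 / real n) *\<^sub>R v) t - g p t))"
    have "(\<lambda>n. norm v / real n) \<longlonglongrightarrow> 0" by (rule lim_const_over_n)
    then have small: "\<forall>\<^sub>F n in sequentially. norm v / real n < \<rho> / 2"
      using \<rho>(1) by (intro order_tendstoD(2)) auto
    have "\<forall>\<^sub>F n in sequentially. continuous_on {0..1} (F n)"
      using small eventually_gt_at_top[of 0]
    proof eventually_elim
      case (elim n)
      have "norm v / real n < \<rho>" using elim(1) \<rho>(1) by linarith
      then have "p + (1 / real n) *\<^sub>R v \<in> U" by (intro near(1)[of _ 0]) auto
      then show ?case unfolding F_def using p by (intro continuous_intros gc)
    qed
    moreover have "uniform_limit {0..1} F (\<lambda>t. D t v) sequentially"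
    proof (rule uniform_limitI)
      fix e :: real assume "e > 0"
      have "(\<lambda>n. 32 * K / \<rho>\<^sup>2 * (norm v)\<^sup>2 / real n) \<longlonglongrightarrow> 0" by (rule lim_const_over_n)
      then have "\<forall>\<^sub>F n in sequentially. 32 * K / \<rho>\<^sup>2 * (norm v)\<^sup>2 / real n < e"
        using \<open>e > 0\<close> by (intro order_tendstoD(2)) auto
      with small eventually_gt_at_top[of 0]
      show "\<forall>\<^sub>F n in sequentially. \<forall>t\<in>{0..1}. dist (F n t) (D t v) < e"
      proof eventually_elim
        case (elim n)
        show ?case
        proof
          fix t :: real assume t: "t \<in> {0..1}"
          let ?v = "(1 / real n) *\<^sub>R v"
          have "D t v = of_nat n * D t ?v"
            using elim linear_scale[OF has_derivative_linear[OF D[of t]], of "1 / real n" v]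
            by (simp add: scaleR_conv_of_real)
          then have "F n t - D t v = of_nat n * (g (p + ?v) t - g p t - D t ?v)"
            by (simp add: F_def algebra_simps)
          then have "dist (F n t) (D t v) = real n * norm (g (p + ?v) t - g p t - D t ?v)"
            by (simp add: dist_norm norm_mult)
          also have "\<dots> \<le> real n * (32 * K / \<rho>\<^sup>2 * (norm ?v)\<^sup>2)"
            using elim by (intro mult_left_mono rem t) auto
          also have "\<dots> = 32 * K / \<rho>\<^sup>2 * (norm v)\<^sup>2 / real n"
            using elim by (simp add: power_divide power2_eq_square)
          also have "\<dots> < e" by (rule elim)
          finally show "dist (F n t) (D t v) < e" .
        qed
      qed
    qed
    ultimately show ?thesis by (rule uniform_limit_theorem) simp
  qed
  have int: "(\<lambda>t. D t v) integrable_on {0..1}" for v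
    by (rule integrable_continuous_real[OF Dc])
  define L where "L = (\<lambda>v. integral {0..1} (\<lambda>t. D t v))"
  have L: "bounded_linear L"
  proof (rule bounded_linear_intro[where K = "2 * K / \<rho>"])
    show "L (x + y) = L x + L y" for x y
      unfolding L_def linear_add[OF has_derivative_linear[OF D]] by (rule integral_add[OF int int])
    show "L (c *\<^sub>R x) = c *\<^sub>R L x" for c x
      unfolding L_def linear_scale[OF has_derivative_linear[OF D]] by (rule integral_cmul)
    show "norm (L x) \<le> norm x * (2 * K / \<rho>)" for x
      unfolding L_def using integral_bound[OF zero_le_one Dc Dbd, of x] by (simp add: mult.commute)
  qed
  have "((\<lambda>p. integral {0..1} (g p)) has_derivative L) (at p)"
  proof (rule has_derivativeI_sandwich[where H = "\<lambda>y. 32 * K / \<rho>\<^sup>2 * norm (y - p)" and e = "\<rho> / 2"])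
    show "((\<lambda>y. 32 * K / \<rho>\<^sup>2 * norm (y - p)) \<longlongrightarrow> 0) (at p)"
      using \<rho>(1) by (auto intro!: tendsto_eq_intros)
    fix y assume y: "y \<noteq> p" "dist y p < \<rho> / 2"
    then have v: "norm (y - p) \<le> \<rho> / 2" by (simp add: dist_norm)
    have yU: "y \<in> U" using near(1)[of y 0] v \<rho>(1) by simp
    have ci: "g q integrable_on {0..1}" if "q \<in> U" for q
      by (rule integrable_continuous_real[OF gc[OF that]])
    have "integral {0..1} (g y) - integral {0..1} (g p) - L (y - p)
        = integral {0..1} (\<lambda>t. g y t - g p t - D t (y - p))"
      using ci[OF yU] ci[OF p] int by (simp add: L_def integral_diff integrable_diff)
    also have "norm \<dots> \<le> 32 * K / \<rho>\<^sup>2 * (norm (y - p))\<^sup>2 * (1 - 0)"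
      using rem[OF v] yU p by (intro integral_bound continuous_intros gc Dc) auto
    finally have "norm (integral {0..1} (g y) - integral {0..1} (g p) - L (y - p)) / norm (y - p)
        \<le> 32 * K / \<rho>\<^sup>2 * (norm (y - p))\<^sup>2 / norm (y - p)"
      by (intro divide_right_mono) auto
    then show "norm (integral {0..1} (g y) - integral {0..1} (g p) - L (y - p)) / norm (y - p)
        \<le> 32 * K / \<rho>\<^sup>2 * norm (y - p)"
      using y by (simp add: power2_eq_square mult.assoc)
  qed (use \<rho> L in auto)
  moreover have "L (jac_scale c v) = c * L v" for c v
    by (simp add: L_def Dsc)
  ultimately show "\<exists>D. ((\<lambda>p. integral {0..1} (g p)) has_derivative D) (at p) \<and> (\<forall>c v. D (jac_scale c v) = c * D v)"
    by blast
qed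


section \<open>Algebraic independence of the functions \<open>\<nu>\<^sub>j\<close>\<close>

text \<open>The tube domain is fibred over \<open>jacobi_domain\<close>, and the fibre over
  \<open>p\<close> is the half-plane of all \<open>\<zeta>\<close> with
  \<open>Im \<zeta> > ht p\<close>.\<close>

definition ht :: "'a::real_inner cx \<times> complex \<Rightarrow> real" where
  "ht p = (snd (fst p) \<bullet> snd (fst p)) / (2 * Im (snd p))"

lemma tube_iff: "(\<zeta>, p) \<in> tube \<longleftrightarrow> p \<in> jacobi_domain \<and> Im \<zeta> > ht p"
proof -
  obtain z \<tau> where p: "p = (z, \<tau>)" by (cases p)
  have "2 * Im \<tau> * Im \<zeta> - snd z \<bullet> snd z > 0 \<longleftrightarrow> Im \<zeta> > ht p" if "Im \<tau> > 0"
    using that by (simp add: p ht_def field_simps)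
  moreover have "ht p \<ge> 0" if "Im \<tau> > 0" using that by (simp add: p ht_def)
  ultimately show ?thesis by (auto simp: p tube_def jacobi_domain_def)
qed

section \<open>The tube domain as an open convex cone\<close>

lemma open_tube: "open (tube :: 'a::real_inner tube_pt set)"
proof -
  have "(tube :: 'a tube_pt set) = {x. 0 < Im (fst x)} \<inter> ({x. 0 < Im (snd (snd x))} \<inter>
      {x. 0 < 2 * Im (snd (snd x)) * Im (fst x) - snd (fst (snd x)) \<bullet> snd (fst (snd x))})"
    by (auto simp: tube_def)
  also have "open \<dots>" by (intro open_Int open_Collect_less continuous_intros)
  finally show ?thesis .
qed

lemma tube_add:
  assumes "z \<in> tube" "w \<in> tube"
  shows "z + w \<in> tube"
proof -
  obtain z1 n1 t1 where z: "z = (z1, n1, t1)" by (cases z) auto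
  obtain z2 n2 t2 where w: "w = (z2, n2, t2)" by (cases w) auto
  let ?a = "snd n1" and ?b = "snd n2" and ?s = "Im t1" and ?t = "Im t2"
  have h: "?s > 0" "?t > 0" "Im z1 > 0" "Im z2 > 0" "?a \<bullet> ?a < 2 * ?s * Im z1" "?b \<bullet> ?b < 2 * ?t * Im z2"
    using assms by (auto simp: z w tube_def)
  \<comment> \<open>The weights in this square are chosen so that its mixed terms combine to a
    multiple of the norm of \<open>?a + ?b\<close>, leaving the two given inequalities to be
    inserted.\<close>
  have "0 \<le> (?t *\<^sub>R ?a - ?s *\<^sub>R ?b) \<bullet> (?t *\<^sub>R ?a - ?s *\<^sub>R ?b)" by simp
  also have "\<dots> = ?t * (?s + ?t) * (?a \<bullet> ?a) + ?s * (?s + ?t) * (?b \<bullet> ?b) - ?s * ?t * ((?a + ?b) \<bullet> (?a + ?b))"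
    by (simp add: inner_simps inner_commute algebra_simps)
  also have "\<dots> < ?t * (?s + ?t) * (2 * ?s * Im z1) + ?s * (?s + ?t) * (2 * ?t * Im z2) - ?s * ?t * ((?a + ?b) \<bullet> (?a + ?b))"
    using h by (intro diff_strict_right_mono add_strict_mono mult_strict_left_mono) auto
  also have "\<dots> = ?s * ?t * (2 * (?s + ?t) * (Im z1 + Im z2) - (?a + ?b) \<bullet> (?a + ?b))"
    by (simp add: algebra_simps)
  finally have "0 < 2 * (?s + ?t) * (Im z1 + Im z2) - (?a + ?b) \<bullet> (?a + ?b)"
    by (rule zero_less_mult_pos) (use h in simp)
  then show ?thesis using h by (simp add: z w tube_def)
qed

lemma tube_scaleR:
  assumes "z \<in> tube" "c > 0"
  shows "c *\<^sub>R z \<in> tube"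
proof -
  obtain z1 n1 t1 where z: "z = (z1, n1, t1)" by (cases z) auto
  have "2 * (c * Im t1) * (c * Im z1) - c *\<^sub>R snd n1 \<bullet> c *\<^sub>R snd n1 = c * c * (2 * Im t1 * Im z1 - snd n1 \<bullet> snd n1)"
    by (simp add: algebra_simps)
  also have "\<dots> > 0" using assms by (auto simp: z tube_def)
  finally show ?thesis using assms by (auto simp: z tube_def)
qed

lemma convex_tube: "convex tube"
proof (rule convexI)
  fix x y :: "'a tube_pt" and u v :: real
  assume "x \<in> tube" "y \<in> tube" "0 \<le> u" "0 \<le> v" "u + v = 1"
  then show "u *\<^sub>R x + v *\<^sub>R y \<in> tube"
    by (cases "u = 0"; cases "v = 0") (auto intro!: tube_add tube_scaleR)
qed

text \<open>The quantity \<epsilon> of the opening comment, see \<open>eps_eq\<close>. On each fibre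
  it takes all positive values, and it tends to 0 as \<open>Im \<zeta>\<close> tends to
  infinity.\<close>

definition eps :: "complex \<Rightarrow> 'a::real_inner cx \<times> complex \<Rightarrow> real" where
  "eps \<zeta> p = 1 / (2 * (Im \<zeta> - ht p))"

text \<open>The value of \<nu> in direction \<open>v\<close>, for \<open>v\<close> with real
  coordinates, with \<open>eps\<close> replaced by a free variable \<open>e\<close>. This gives a
  meaning to \<open>e = 0\<close>, which no point of the tube domain attains.\<close>

definition nu_at :: "'a::real_inner tube_pt \<Rightarrow> real \<Rightarrow> 'a cx \<times> complex \<Rightarrow> complex" where
  "nu_at v e p = - \<i> * of_real
     (e * (Re (fst v) - (snd (fst p) \<bullet> fst (fst (snd v))) / Im (snd p) + Re (snd (snd v)) * ht p / Im (snd p))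
        + Re (snd (snd v)) / (2 * Im (snd p)))"

text \<open>The logarithm depends on imaginary parts only, so its Wirtinger derivative is
  \<open>- \<i> / 2\<close> times the real derivative in the direction
  \<open>\<i> v\<close>.\<close>

lemma \<nu>_fun_real_direction:
  fixes b :: "'a::real_inner"
  assumes r: "r \<ge> 1" and mem: "(\<zeta>, p) \<in> tube"
  shows "\<nu>_fun r (of_real s, cx_of b, of_real t) (\<zeta>, p) = nu_at (of_real s, cx_of b, of_real t) (eps \<zeta> p) p"
proof -
  obtain n' n \<tau> where p: "p = ((n', n), \<tau>)" by (cases p) auto
  define q where "q = (\<lambda>x :: 'a tube_pt. real r * (2 * Im (fst x) * Im (snd (snd x)) - snd (fst (snd x)) \<bullet> snd (fst (snd x))))"
  have q: "bil r (snd (tube_vec x)) (snd (tube_vec x)) = q x" for x :: "'a tube_pt"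
    by (cases x) (auto simp: q_def tube_vec_def cx_scale_def cx_of_def vec_e1_def vec_N_def vec_f1_def map_prod_def
        split_beta bil_def algebra_simps)
  define Q where "Q = 2 * Im \<zeta> * Im \<tau> - n \<bullet> n"
  have pos: "Im \<tau> > 0" "Q > 0" using mem by (auto simp: p tube_def Q_def mult_ac)
  define G where "G = (\<lambda>h :: 'a tube_pt. (2 * (Im (fst h) * Im \<tau> + Im \<zeta> * Im (snd (snd h))) - 2 * (n \<bullet> snd (fst (snd h)))) / Q)"
  have qz: "q (\<zeta>, p) = real r * Q" by (simp add: q_def p Q_def)
  have q0: "q (\<zeta>, p) > 0" using pos r by (simp add: qz)
  have bl: "bounded_linear (\<lambda>x :: 'a tube_pt. Im (fst x))" "bounded_linear (\<lambda>x :: 'a tube_pt. Im (snd (snd x)))"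
    "bounded_linear (\<lambda>x :: 'a tube_pt. snd (fst (snd x)))"
    by (intro bounded_linear_compose[OF bounded_linear_Im] bounded_linear_fst_comp bounded_linear_snd_comp
        bounded_linear_ident)+
  have "(q has_derivative (\<lambda>h. real r * (2 * (Im (fst h) * Im \<tau> + Im \<zeta> * Im (snd (snd h))) - 2 * (n \<bullet> snd (fst (snd h))))))
      (at (\<zeta>, p))"
    unfolding q_def
    by (auto intro!: derivative_eq_intros bl[THEN bounded_linear_imp_has_derivative]
        simp: p inner_commute algebra_simps fun_eq_iff)
  from has_derivative_ln[OF q0 this] have "((\<lambda>x. ln (q x)) has_derivative G) (at (\<zeta>, p))"
    by (rule has_derivative_eq_rhs) (use pos r in \<open>auto simp: qz G_def fun_eq_iff field_simps\<close>)
  then have fd: "frechet_derivative (\<lambda>x. ln (q x)) (at (\<zeta>, p)) = G"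
    by (rule frechet_derivative_at[symmetric])
  have e: "eps \<zeta> p = Im \<tau> / Q"
    using pos by (simp add: eps_def ht_def p Q_def field_simps)
  have "\<nu>_fun r (of_real s, cx_of b, of_real t) (\<zeta>, p) = - \<i> * of_real ((s * Im \<tau> + Im \<zeta> * t - n \<bullet> b) / Q)"
    unfolding \<nu>_fun_def wirtinger_def q fd
    using pos by (simp add: G_def tube_scale_def cx_scale_def cx_of_def complex_eq_iff field_simps)
  \<comment> \<open>Replacing \<open>Im \<zeta>\<close> by \<open>Q\<close> splits
    \<open>Im \<zeta> / Q\<close> into the \<epsilon>-free summand
    \<open>1 / (2 * Im \<tau>)\<close> and a multiple of \<open>eps\<close>.\<close>
  also have "(s * Im \<tau> + Im \<zeta> * t - n \<bullet> b) / Q =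
      eps \<zeta> p * (s - (n \<bullet> b) / Im \<tau> + t * ht p / Im \<tau>) + t / (2 * Im \<tau>)"
  proof -
    have y: "Im \<zeta> = Q / (2 * Im \<tau>) + (n \<bullet> n) / (2 * Im \<tau>)"
      using pos by (simp add: Q_def field_simps)
    show ?thesis
      using pos unfolding e y by (simp add: ht_def p field_simps)
  qed
  finally show ?thesis by (simp add: nu_at_def p cx_of_def)
qed

lemma \<nu>_fun_basis:
  assumes "r \<ge> 1" "(\<zeta>, p) \<in> tube" "v \<in> tube_basis B"
  shows "\<nu>_fun r v (\<zeta>, p) = nu_at v (eps \<zeta> p) p"
  using assms(3) \<nu>_fun_real_direction[OF assms(1,2), of 1 0 0] \<nu>_fun_real_direction[OF assms(1,2), of 0 0 1]
    \<nu>_fun_real_direction[OF assms(1,2), of 0 _ 0]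
  by (auto simp: tube_basis_def cx_of_def zero_prod_def)

text \<open>Induction on the variables. With the others fixed, the polynomial in \<open>x i\<close>
  has infinitely many roots, so its coefficient at exponent \<open>e a i\<close> vanishes. That is a
  relation in fewer variables among the monomials in \<open>K0\<close>, still pairwise
  distinct.\<close>

lemma polynomial_zero_on_product:
  fixes X :: "'j \<Rightarrow> complex set" and d :: "'k \<Rightarrow> complex"
  assumes "finite I" "finite K" "\<And>j. j \<in> I \<Longrightarrow> infinite (X j)"
    and "\<And>a b. a \<in> K \<Longrightarrow> b \<in> K \<Longrightarrow> a \<noteq> b \<Longrightarrow> \<exists>j\<in>I. e a j \<noteq> e b j"
    and "\<And>x. (\<And>j. j \<in> I \<Longrightarrow> x j \<in> X j) \<Longrightarrow> (\<Sum>a\<in>K. d a * (\<Prod>j\<in>I. x j ^ e a j)) = 0"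
    and "a \<in> K"
  shows "d a = 0"
  using assms
proof (induction I arbitrary: K a rule: finite_induct)
  case empty
  then have "K = {a}" by auto
  then show ?case using empty.prems(4) by simp
next
  case (insert i I)
  define K0 where "K0 = {b \<in> K. e b i = e a i}"
  show ?case
  proof (rule insert.IH[of K0])
    show "finite K0" using insert.prems by (simp add: K0_def)
    show "\<exists>j\<in>I. e b j \<noteq> e c j" if "b \<in> K0" "c \<in> K0" "b \<noteq> c" for b c
      using insert.prems(3)[of b c] that by (auto simp: K0_def)
    show "a \<in> K0" using insert.prems by (simp add: K0_def)
    show "infinite (X j)" if "j \<in> I" for j using insert.prems that by simp
    fix x assume x: "\<And>j. j \<in> I \<Longrightarrow> x j \<in> X j"
    define P where "P = (\<Sum>b\<in>K. monom (d b * (\<Prod>j\<in>I. x j ^ e b j)) (e b i))"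
    have "poly P y = 0" if y: "y \<in> X i" for y
    proof -
      have step: "(\<Prod>j\<in>insert i I. (x(i := y)) j ^ e b j) = y ^ e b i * (\<Prod>j\<in>I. x j ^ e b j)" for b
      proof -
        have "(\<Prod>j\<in>I. (x(i := y)) j ^ e b j) = (\<Prod>j\<in>I. x j ^ e b j)"
          by (rule prod.cong) (use insert.hyps in auto)
        then show ?thesis using insert.hyps by simp
      qed
      have "(\<Sum>b\<in>K. d b * (\<Prod>j\<in>insert i I. (x(i := y)) j ^ e b j)) = 0"
        using x y by (intro insert.prems(4)) auto
      then show ?thesis unfolding step by (simp add: P_def poly_sum poly_monom mult_ac)
    qed
    then have "X i \<subseteq> {y. poly P y = 0}" by auto
    then have "infinite {y. poly P y = 0}" using insert.prems(2)[of i] finite_subset by blast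
    then have "P = 0" using poly_roots_finite by blast
    then have "coeff P (e a i) = 0" by simp
    then show "(\<Sum>b\<in>K0. d b * (\<Prod>j\<in>I. x j ^ e b j)) = 0"
      using insert.prems(1) by (simp add: P_def coeff_sum coeff_monom K0_def sum.inter_filter)
  qed
qed

text \<open>The component \<open>u\<close> of \<open>b\<close> orthogonal to the span of the other
  basis vectors satisfies \<open>u \<bullet> b = u \<bullet> u\<close>; dividing it by this number
  gives the dual vector.\<close>

lemma dual_vector_exists:
  fixes B :: "'a::real_inner set"
  assumes B: "finite B" "independent B" "b \<in> B"
  shows "\<exists>d. \<forall>c\<in>B. d \<bullet> c = (if c = b then 1 else 0)"
proof -
  obtain C where C: "finite C" "span C = span (B - {b})" "pairwise orthogonal C"
    using basis_orthogonal[of "B - {b}"] B by auto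
  define u where "u = b - (\<Sum>c\<in>C. (c \<bullet> b / (c \<bullet> c)) *\<^sub>R c)"
  have uC: "u \<bullet> x = 0" if x: "x \<in> C" for x
  proof -
    have "(\<Sum>c\<in>C. (c \<bullet> b / (c \<bullet> c)) *\<^sub>R c) \<bullet> x = (\<Sum>c\<in>C. if c = x then x \<bullet> b else 0)"
      unfolding inner_sum_left
      using C(3) x by (intro sum.cong) (auto simp: pairwise_def orthogonal_def)
    also have "\<dots> = b \<bullet> x" using C(1) x by (simp add: inner_commute)
    finally show ?thesis by (simp add: u_def inner_diff_left)
  qed
  have orth: "u \<bullet> x = 0" if "x \<in> span (B - {b})" for x
    using that unfolding C(2)[symmetric]
    by (induction rule: span_induct_alt) (simp_all add: inner_simps uC)
  have "u \<noteq> 0"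
  proof
    assume "u = 0"
    then have "b = (\<Sum>c\<in>C. (c \<bullet> b / (c \<bullet> c)) *\<^sub>R c)" by (simp add: u_def)
    also have "\<dots> \<in> span C" by (intro span_sum span_scale span_base)
    finally show False using B C(2) by (auto simp: dependent_def)
  qed
  have "u \<bullet> (\<Sum>c\<in>C. (c \<bullet> b / (c \<bullet> c)) *\<^sub>R c) = 0"
    by (simp add: inner_sum_right uC)
  then have ub: "u \<bullet> b = u \<bullet> u" by (simp add: u_def inner_diff_right)
  have "(u /\<^sub>R (u \<bullet> u)) \<bullet> c = (if c = b then 1 else 0)" if "c \<in> B" for c
  proof (cases "c = b")
    case True then show ?thesis using ub \<open>u \<noteq> 0\<close> by simp
  next
    case False
    then show ?thesis using orth[of c] that by (simp add: span_base)
  qed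
  then show ?thesis by blast
qed

text \<open>
  For a vector \<open>v\<close> with real coordinates, the \<open>\<nu>\<close>-values are constant along the horizontal lines of the
  strip \<open>{z. z\<^sub>0 + z v \<in> tube}\<close>, so the identity theorem moves a relation from one line to all of it.
\<close>

lemma relation_freeze:
  fixes d :: "'k \<Rightarrow> 'a::real_inner tube_pt \<Rightarrow> complex"
  assumes fin: "finite K" and d: "\<And>a. a \<in> K \<Longrightarrow> holo_on tube_scale tube (d a)"
    and rel: "\<And>z. z \<in> tube \<Longrightarrow> (\<Sum>a\<in>K. d a z * P a z) = 0"
    and P: "\<And>a z x. a \<in> K \<Longrightarrow> z \<in> tube \<Longrightarrow> z + tube_scale (of_real x) v \<in> tube \<Longrightarrow>
      P a (z + tube_scale (of_real x) v) = P a z"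
    and z0: "z0 \<in> tube" and z1: "z0 + tube_scale \<i> v \<in> tube"
    and line: "\<And>x z. z \<in> tube \<Longrightarrow> z + tube_scale (of_real x) v \<in> tube"
  shows "(\<Sum>a\<in>K. d a z0 * P a (z0 + tube_scale \<i> v)) = 0"
proof -
  let ?z1 = "z0 + tube_scale \<i> v"
  note bl = bounded_linear_tube_scale[of v]
  note lin = bounded_linear.linear[OF bl]
  define T where "T = {z. z0 + tube_scale z v \<in> tube}"
  \<comment> \<open>The coefficients move along the complex line while the factors \<open>P\<close>
    are frozen at \<open>?z1\<close>. This makes \<open>H\<close> holomorphic although
    \<open>P\<close> need not be.\<close>
  define H where "H = (\<lambda>z. \<Sum>a\<in>K. d a (z0 + tube_scale z v) * P a ?z1)"
  have hol: "H holomorphic_on T"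
    unfolding H_def by (intro holomorphic_intros holo_on_line_holomorphic[OF d bl]) (auto simp: T_def)
  have "open ((\<lambda>z. z0 + tube_scale z v) -` tube)"
    by (intro open_vimage open_tube continuous_intros bounded_linear.continuous_on[OF bl])
  then have oT: "open T" by (simp add: T_def vimage_def)
  have "convex T"
  proof (rule convexI)
    fix x y :: complex and a b :: real
    assume xy: "x \<in> T" "y \<in> T" and ab: "0 \<le> a" "0 \<le> b" "a + b = 1"
    then have "a *\<^sub>R (z0 + tube_scale x v) + b *\<^sub>R (z0 + tube_scale y v) \<in> tube"
      by (intro convexD[OF convex_tube]) (auto simp: T_def)
    also have "a *\<^sub>R (z0 + tube_scale x v) + b *\<^sub>R (z0 + tube_scale y v)
        = (a + b) *\<^sub>R z0 + tube_scale (a *\<^sub>R x + b *\<^sub>R y) v"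
      by (simp add: linear_add[OF lin] linear_scale[OF lin] algebra_simps)
    finally show "a *\<^sub>R x + b *\<^sub>R y \<in> T" using ab by (simp add: T_def)
  qed
  \<comment> \<open>The horizontal line at height 1: there \<open>P\<close> really has its frozen
    value, so the relation gives \<open>H = 0\<close>. The identity theorem carries this to the
    parameter 0.\<close>
  define L where "L = range (\<lambda>x. of_real x + \<i>)"
  have shift: "z0 + tube_scale (of_real x + \<i>) v = ?z1 + tube_scale (of_real x) v" for x
    by (simp add: linear_add[OF lin])
  have LT: "L \<subseteq> T" using line[OF z1] by (auto simp: L_def T_def shift)
  have "\<i> islimpt L"
    unfolding islimpt_approachable
  proof (intro allI impI)
    fix e :: real assume "e > 0"
    then show "\<exists>x'\<in>L. x' \<noteq> \<i> \<and> dist x' \<i> < e"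
      by (intro bexI[of _ "of_real (e / 2) + \<i>"]) (auto simp: L_def dist_norm simp del: of_real_divide)
  qed
  have 0: "H z = 0" if "z \<in> L" for z
  proof -
    from that obtain x where x: "z = of_real x + \<i>" by (auto simp: L_def)
    have "H z = (\<Sum>a\<in>K. d a (?z1 + tube_scale (of_real x) v) * P a (?z1 + tube_scale (of_real x) v))"
      unfolding H_def x shift using P[OF _ z1 line[OF z1]] by (intro sum.cong) auto
    also have "\<dots> = 0" by (rule rel[OF line[OF z1]])
    finally show ?thesis .
  qed
  have "tube_scale 0 v = 0" by (rule linear_0[OF lin])
  then have "0 \<in> T" "\<i> \<in> T" using z0 z1 by (auto simp: T_def)
  have "H 0 = 0"
    by (rule analytic_continuation[OF hol oT convex_connected[OF \<open>convex T\<close>] LT \<open>\<i> \<in> T\<close> \<open>\<i> islimpt L\<close> 0 \<open>0 \<in> T\<close>])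
  then show ?thesis using \<open>tube_scale 0 v = 0\<close> by (simp add: H_def)
qed

text \<open>The \<nu>-values depend on imaginary parts only. Freezing them therefore decouples the
  coefficients, taken at \<open>z0\<close>, from the \<nu>-values, taken at an arbitrary
  \<open>z1\<close>.\<close>

lemma relation_independent_points:
  fixes d :: "'a::real_inner tube_pt multiset \<Rightarrow> 'a tube_pt \<Rightarrow> complex"
  assumes r: "r \<ge> 1" and fin: "finite \<A>"
    and d: "\<And>A. A \<in> \<A> \<Longrightarrow> set_mset A \<subseteq> tube_basis B \<and> holo_on tube_scale tube (d A)"
    and rel: "\<And>z. z \<in> tube \<Longrightarrow> (\<Sum>A\<in>\<A>. d A z * (\<Prod>j\<in>#A. \<nu>_fun r j z)) = 0"
    and z0: "z0 \<in> tube" and z1: "z1 \<in> tube"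
  shows "(\<Sum>A\<in>\<A>. d A z0 * (\<Prod>j\<in>#A. \<nu>_fun r j z1)) = 0"
proof -
  obtain a0 b0 c0 where e0: "z0 = (a0, b0, c0)" by (cases z0) auto
  obtain a1 b1 c1 where e1: "z1 = (a1, b1, c1)" by (cases z1) auto
  \<comment> \<open>A vector with real coordinates such that \<open>z0 + tube_scale \<i> v\<close>
    has the same imaginary part as \<open>z1\<close>.\<close>
  define v :: "'a tube_pt" where "v = (of_real (Im a1 - Im a0), cx_of (snd b1 - snd b0), of_real (Im c1 - Im c0))"
  have line: "z + tube_scale (of_real x) v \<in> tube" if "z \<in> tube" for z x
    using that by (cases z) (auto simp: tube_def v_def tube_scale_def cx_scale_def cx_of_def)
  have same: "\<nu>_fun r j z = \<nu>_fun r j z'"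
    if "j \<in> tube_basis B" "z \<in> tube" "z' \<in> tube" "Im (fst z) = Im (fst z')" "snd (fst (snd z)) = snd (fst (snd z'))"
      "Im (snd (snd z)) = Im (snd (snd z'))" for j z z'
    using that \<nu>_fun_basis[OF r, of "fst z" "snd z" j B] \<nu>_fun_basis[OF r, of "fst z'" "snd z'" j B]
    by (simp add: nu_at_def eps_def ht_def)
  have prod_same: "(\<Prod>j\<in>#A. \<nu>_fun r j z) = (\<Prod>j\<in>#A. \<nu>_fun r j z')"
    if "A \<in> \<A>" "z \<in> tube" "z' \<in> tube" "Im (fst z) = Im (fst z')" "snd (fst (snd z)) = snd (fst (snd z'))"
      "Im (snd (snd z)) = Im (snd (snd z'))" for A z z'
    using d[OF that(1)] same[OF _ that(2-)]
    by (intro arg_cong[of _ _ prod_mset] image_mset_cong) auto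
  have mem: "z0 + tube_scale \<i> v \<in> tube"
    using z1 z0 by (auto simp: e0 e1 tube_def v_def tube_scale_def cx_scale_def cx_of_def)
  have "(\<Sum>A\<in>\<A>. d A z0 * (\<Prod>j\<in>#A. \<nu>_fun r j (z0 + tube_scale \<i> v))) = 0"
  proof (rule relation_freeze[where P = "\<lambda>A z. \<Prod>j\<in>#A. \<nu>_fun r j z", OF fin _ rel _ z0 mem line])
    show "holo_on tube_scale tube (d A)" if "A \<in> \<A>" for A using d[OF that] by simp
    show "(\<Prod>j\<in>#A. \<nu>_fun r j (z + tube_scale (of_real x) v)) = (\<Prod>j\<in>#A. \<nu>_fun r j z)"
      if "A \<in> \<A>" "z \<in> tube" "z + tube_scale (of_real x) v \<in> tube" for A z x
      using that by (intro prod_same) (auto simp: v_def tube_scale_def cx_scale_def cx_of_def split: prod.split)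
  qed
  also have "(\<Sum>A\<in>\<A>. d A z0 * (\<Prod>j\<in>#A. \<nu>_fun r j (z0 + tube_scale \<i> v)))
      = (\<Sum>A\<in>\<A>. d A z0 * (\<Prod>j\<in>#A. \<nu>_fun r j z1))"
    using z1 mem by (intro sum.cong refl arg_cong2[where f = "(*)"] prod_same)
      (auto simp: v_def e0 e1 tube_scale_def cx_scale_def cx_of_def)
  finally show ?thesis .
qed

text \<open>The \<nu>-values fill a product of infinite sets, as
  \<open>polynomial_zero_on_product\<close> demands. The bounds on \<open>e\<close>,
  \<open>s\<close> and \<open>w\<close> ensure that \<open>Im \<tau>\<close>, found by solving for
  the last value, is positive.\<close>

lemma \<nu>_fun_values:
  fixes B :: "'a::real_inner set"
  assumes r: "r \<ge> 1" and D: "\<And>b c. b \<in> B \<Longrightarrow> c \<in> B \<Longrightarrow> D b \<bullet> c = (if c = b then 1 else 0)" and B: "finite B"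
    and e: "e > 1" and s: "\<And>b. b \<in> B \<Longrightarrow> s b \<in> {0<..<1}" and w: "w > (\<Sum>b\<in>B. norm (D b))\<^sup>2"
  obtains z where "z \<in> tube" "\<nu>_fun r (1, 0, 0) z = - \<i> * of_real e"
    "\<And>b. b \<in> B \<Longrightarrow> \<nu>_fun r (0, cx_of b, 0) z = \<i> * of_real (s b)"
    "\<nu>_fun r (0, 0, 1) z = - \<i> * of_real w"
proof -
  define \<beta> where "\<beta> = (\<Sum>b\<in>B. s b *\<^sub>R D b)"
  have "norm \<beta> \<le> (\<Sum>b\<in>B. norm (D b))"
    unfolding \<beta>_def
  proof (rule sum_norm_le)
    fix b assume "b \<in> B"
    then show "norm (s b *\<^sub>R D b) \<le> norm (D b)" using s[of b] by (simp add: mult_left_le_one_le)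
  qed
  then have "(norm \<beta>)\<^sup>2 \<le> (\<Sum>b\<in>B. norm (D b))\<^sup>2" by (intro power_mono) auto
  then have "\<beta> \<bullet> \<beta> < w" using w by (simp add: power2_norm_eq_inner)
  moreover have "w > 0" using w by (rule le_less_trans[rotated]) simp
  moreover have "\<beta> \<bullet> \<beta> / e \<le> \<beta> \<bullet> \<beta>" using e by (simp add: divide_le_eq mult_le_cancel_left1 not_less)
  ultimately have pos: "2 * w - \<beta> \<bullet> \<beta> / e > 0" by linarith
  have \<beta>b: "\<beta> \<bullet> b = s b" if "b \<in> B" for b
  proof -
    have "\<beta> \<bullet> b = (\<Sum>c\<in>B. if c = b then s c else 0)"
      unfolding \<beta>_def inner_sum_left using D that by (intro sum.cong) auto
    also have "\<dots> = s b" using B that by simp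
    finally show ?thesis .
  qed
  \<comment> \<open>\<open>t\<close> will be \<open>Im \<tau>\<close>. With imaginary part
    \<open>(t / e) *\<^sub>R \<beta>\<close> in the \<open>N\<close>-direction, the equation for
    \<open>w\<close> becomes \<open>\<beta> \<bullet> \<beta> / (2 * e) + 1 / (2 * t) = w\<close>,
    and this is its solution.\<close>
  define t where "t = 1 / (2 * w - \<beta> \<bullet> \<beta> / e)"
  have t: "t > 0" "1 / t = 2 * w - \<beta> \<bullet> \<beta> / e" using pos by (simp_all add: t_def)
  define p :: "'a cx \<times> complex" where "p = ((0, (t / e) *\<^sub>R \<beta>), Complex 0 t)"
  have p_proj: "snd (fst p) = (t / e) *\<^sub>R \<beta>" "Im (snd p) = t" by (simp_all add: p_def)
  define \<zeta> where "\<zeta> = Complex 0 (1 / (2 * e) + ht p)"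
  have eps: "eps \<zeta> p = e" using e by (simp add: eps_def \<zeta>_def)
  have mem: "(\<zeta>, p) \<in> tube" using t e by (simp add: tube_iff \<zeta>_def p_def jacobi_domain_def)
  have h: "ht p = t * (\<beta> \<bullet> \<beta>) / (2 * e * e)" using t e by (simp add: ht_def p_def field_simps)
  show ?thesis
  proof (rule that[OF mem])
    show "\<nu>_fun r (1, 0, 0) (\<zeta>, p) = - \<i> * of_real e"
      using \<nu>_fun_basis[OF r mem, of "(1, 0, 0)" B] by (simp add: tube_basis_def nu_at_def eps)
    show "\<nu>_fun r (0, cx_of b, 0) (\<zeta>, p) = \<i> * of_real (s b)" if "b \<in> B" for b
    proof -
      have "(0, cx_of b, 0) \<in> tube_basis B" using that by (auto simp: tube_basis_def)
      from \<nu>_fun_basis[OF r mem this] show ?thesis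
        using t(1) e \<beta>b[OF that] by (simp add: nu_at_def eps cx_of_def p_proj)
    qed
    have "e * (ht p / t) + 1 / (2 * t) = w"
    proof -
      have "e * (ht p / t) = \<beta> \<bullet> \<beta> / e / 2" using t(1) e by (simp add: h)
      moreover have "1 / (2 * t) = (2 * w - \<beta> \<bullet> \<beta> / e) / 2" using t(2) by simp
      ultimately show ?thesis by simp
    qed
    then show "\<nu>_fun r (0, 0, 1) (\<zeta>, p) = - \<i> * of_real w"
      using \<nu>_fun_basis[OF r mem, of "(0, 0, 1)" B] by (simp add: tube_basis_def nu_at_def eps p_proj)
  qed
qed

text \<open>With the coefficients fixed at \<open>z0\<close>, the relation is a polynomial with
  constant coefficients that vanishes at all \<nu>-values of the tube domain, hence on a product of
  infinite sets.\<close>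

lemma \<nu>_fun_independent:
  fixes d :: "'a::real_inner tube_pt multiset \<Rightarrow> 'a tube_pt \<Rightarrow> complex"
  assumes r: "r \<ge> 1" and B: "finite B" "independent B" and fin: "finite \<A>"
    and d: "\<And>A. A \<in> \<A> \<Longrightarrow> set_mset A \<subseteq> tube_basis B \<and> holo_on tube_scale tube (d A)"
    and rel: "\<And>z. z \<in> tube \<Longrightarrow> (\<Sum>A\<in>\<A>. d A z * (\<Prod>j\<in>#A. \<nu>_fun r j z)) = 0"
    and A: "A \<in> \<A>" and z0: "z0 \<in> tube"
  shows "d A z0 = 0"
proof -
  have "\<forall>b\<in>B. \<exists>d. \<forall>c\<in>B. d \<bullet> c = (if c = b then 1 else 0)"
    using dual_vector_exists[OF B] by blast
  then obtain D where D: "\<And>b c. b \<in> B \<Longrightarrow> c \<in> B \<Longrightarrow> D b \<bullet> c = (if c = b then 1 else 0)" by metis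
  define M where "M = (\<Sum>b\<in>B. norm (D b))\<^sup>2"
  \<comment> \<open>The ranges provided by \<open>\<nu>_fun_values\<close>, with the factors
    \<open>\<i>\<close> and \<open>- \<i>\<close> of the \<nu>-values included.\<close>
  define X where "X = (\<lambda>j :: 'a tube_pt. if j = (1, 0, 0) then (\<lambda>s. - \<i> * of_real s) ` {1<..}
      else if j = (0, 0, 1) then (\<lambda>s. - \<i> * of_real s) ` {M<..} else (\<lambda>s. \<i> * of_real s) ` {0<..<1})"
  have tb: "tube_basis B = {(1, 0, 0), (0, 0, 1)} \<union> (\<lambda>b. (0, cx_of b, 0)) ` B"
    by (auto simp: tube_basis_def)
  have finI: "finite (tube_basis B)" using B by (simp add: tb)
  show ?thesis
  proof (rule polynomial_zero_on_product[OF finI fin, where d = "\<lambda>A. d A z0" and X = X and e = count, OF _ _ _ A])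
    show "infinite (X j)" for j
      by (auto simp: X_def finite_image_iff inj_on_def infinite_Ioi infinite_Ioo)
    show "\<exists>j\<in>tube_basis B. count A j \<noteq> count A' j" if "A \<in> \<A>" "A' \<in> \<A>" "A \<noteq> A'" for A A'
    proof (rule ccontr)
      assume *: "\<not> ?thesis"
      have "count A j = count A' j" for j
      proof (cases "j \<in> tube_basis B")
        case False
        then have "j \<notin># A" "j \<notin># A'" using d[OF that(1)] d[OF that(2)] by blast+
        then show ?thesis by (simp add: not_in_iff)
      qed (use * in blast)
      then show False using that(3) multiset_eqI by blast
    qed
    fix x :: "'a tube_pt \<Rightarrow> complex"
    assume x: "\<And>j. j \<in> tube_basis B \<Longrightarrow> x j \<in> X j"
    obtain e where e: "e > 1" "x (1, 0, 0) = - \<i> * of_real e"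
      using x[of "(1, 0, 0)"] by (auto simp: X_def tb)
    obtain w where w: "w > M" "x (0, 0, 1) = - \<i> * of_real w"
      using x[of "(0, 0, 1)"] by (auto simp: X_def tb)
    have "\<forall>b\<in>B. \<exists>s. s \<in> {0<..<1} \<and> x (0, cx_of b, 0) = \<i> * of_real s"
    proof
      fix b assume "b \<in> B"
      then show "\<exists>s. s \<in> {0<..<1} \<and> x (0, cx_of b, 0) = \<i> * of_real s"
        using x[of "(0, cx_of b, 0)"] by (auto simp: X_def tb)
    qed
    then obtain s where s: "\<And>b. b \<in> B \<Longrightarrow> s b \<in> {0<..<1}" "\<And>b. b \<in> B \<Longrightarrow> x (0, cx_of b, 0) = \<i> * of_real (s b)"
      by metis
    obtain z where z: "z \<in> tube" "\<nu>_fun r (1, 0, 0) z = - \<i> * of_real e"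
      "\<And>b. b \<in> B \<Longrightarrow> \<nu>_fun r (0, cx_of b, 0) z = \<i> * of_real (s b)"
      "\<nu>_fun r (0, 0, 1) z = - \<i> * of_real w"
    proof (rule \<nu>_fun_values[where r = r and B = B and D = D and e = e and s = s and w = w])
      show "(\<Sum>b\<in>B. norm (D b))\<^sup>2 < w" using w by (simp add: M_def)
    qed (use r D B e s in blast)+
    have x_eq: "\<nu>_fun r j z = x j" if "j \<in> tube_basis B" for j
      using that z e w s by (auto simp: tb)
    have "(\<Prod>j\<in>tube_basis B. x j ^ count A j) = (\<Prod>j\<in>#A. \<nu>_fun r j z)" if "A \<in> \<A>" for A
    proof -
      have "(\<Prod>j\<in>#A. \<nu>_fun r j z) = (\<Prod>j\<in>set_mset A. \<nu>_fun r j z ^ count A j)"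
        by (rule image_prod_mset_multiplicity)
      also have "\<dots> = (\<Prod>j\<in>tube_basis B. \<nu>_fun r j z ^ count A j)"
        using d[OF that] finI by (intro prod.mono_neutral_left) (auto simp: not_in_iff)
      finally show ?thesis by (simp add: x_eq)
    qed
    then show "(\<Sum>A\<in>\<A>. d A z0 * (\<Prod>j\<in>tube_basis B. x j ^ count A j)) = 0"
      using relation_independent_points[OF r fin d rel z0 z(1)] by simp
  qed
qed


section \<open>The action of the Jacobi group\<close>

text \<open>The transvections that generate the Heisenberg group have vanishing third power, so the
  exponential series stops at the quadratic term.\<close>

lemma op_exp_nilpotent:
  fixes T :: "'v::real_normed_vector \<Rightarrow> 'v"
  assumes "T 0 = 0" "T (T (T x)) = 0"
  shows "op_exp T x = x + T x + (1 / 2) *\<^sub>R T (T x)"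
proof -
  have "(T ^^ n) x = 0" if "n \<ge> 3" for n
    using that assms by (induction n rule: dec_induct) (simp_all add: numeral_3_eq_3)
  then have "op_exp T x = (\<Sum>n\<in>{0, 1, 2}. (T ^^ n) x /\<^sub>R fact n)"
    unfolding op_exp_def by (intro suminf_finite) auto
  then show ?thesis by (simp add: numeral_2_eq_2 add.assoc)
qed

lemma op_exp_e1_e:
  "op_exp (\<lambda>w. c *\<^sub>R wedge r vec_e1 vec_e w) (u, u1, n, v1, v) = (u - real r * c * v1, u1 + c * v, n, v1, v)"
  by (subst op_exp_nilpotent) (simp_all add: wedge_def bil_def vec_e1_def vec_e_def zero_prod_def algebra_simps)

lemma op_exp_N_e:
  "op_exp (wedge r (vec_N y) vec_e) (u, u1, n, v1, v) =
     (u + real r * (y \<bullet> n) + real r * v * (y \<bullet> y) / 2, u1, n + v *\<^sub>R y, v1, v)"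
  by (subst op_exp_nilpotent) (simp_all add: wedge_def bil_def vec_N_def vec_e_def zero_prod_def algebra_simps)

lemma op_exp_N_e1:
  assumes "r \<ge> 1"
  shows "op_exp (\<lambda>w. wedge r (vec_N x) vec_e1 w /\<^sub>R real r) (u, u1, n, v1, v) =
     (u, u1 + x \<bullet> n + v1 * (x \<bullet> x) / 2, n + v1 *\<^sub>R x, v1, v)"
proof -
  have [simp]: "real r * (inverse (real r) * t) = t" for t using assms by simp
  show ?thesis
    using assms
    by (subst op_exp_nilpotent) (simp_all add: wedge_def bil_def vec_N_def vec_e1_def zero_prod_def algebra_simps)
qed

lemma heis_embed_apply:
  assumes "r \<ge> 1"
  shows "heis_embed r (x, y, \<kappa>) (u, u1, n, v1, v) =
    (u - real r * (\<kappa> - x \<bullet> y / 2) * v1 + real r * (y \<bullet> n) + real r * v * (y \<bullet> y) / 2,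
     u1 + (\<kappa> - x \<bullet> y / 2) * v + x \<bullet> (n + v *\<^sub>R y) + v1 * (x \<bullet> x) / 2, n + v *\<^sub>R y + v1 *\<^sub>R x, v1, v)"
  by (simp add: heis_embed_def op_exp_e1_e op_exp_N_e op_exp_N_e1[OF assms])

section \<open>The action on the tube domain and the slash action\<close>

definition jac_j :: "'a::real_inner jac \<Rightarrow> 'a cx \<times> complex \<Rightarrow> complex" where
  "jac_j = (\<lambda>((a, b, c, d), h) (z, \<tau>). of_real c * \<tau> + of_real d)"

definition jac_translate :: "'a::real_inner jac \<Rightarrow> 'a cx \<times> complex \<Rightarrow> 'a cx" where
  "jac_translate = (\<lambda>(A, (x, y, \<kappa>)) (z, \<tau>). z + cx_scale \<tau> (cx_of x) + cx_of y)"

definition jac_act :: "'a::real_inner jac \<Rightarrow> 'a cx \<times> complex \<Rightarrow> 'a cx \<times> complex" where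
  "jac_act g p = (case g of ((a, b, c, d), h) \<Rightarrow>
     (cx_scale (inverse (jac_j g p)) (jac_translate g p), (of_real a * snd p + of_real b) / jac_j g p))"

text \<open>The factor of the index in the exponent of the slash action. By
  \<open>jacobi_embed_action\<close> it is also the displacement of \<open>\<zeta>\<close>, which is
  why an \<open>m\<close>-th Fourier coefficient acquires index \<open>m\<close>.\<close>

definition jac_shift :: "'a::real_inner jac \<Rightarrow> 'a cx \<times> complex \<Rightarrow> complex" where
  "jac_shift g p = (case g of ((a, b, c, d), (x, y, \<kappa>)) \<Rightarrow>
     - (of_real c * cx_bilinear (\<bullet>) (jac_translate g p) (jac_translate g p)) / (2 * jac_j g p)
       + of_real (x \<bullet> x) * snd p / 2 + cx_bilinear (\<bullet>) (cx_of x) (fst p) + of_real (x \<bullet> y) / 2 + of_real \<kappa>)"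

lemma slash_eq:
  "slash k m g \<phi> p = jac_j g p powi (- k) * \<phi> (jac_act g p) * e_exp (of_int m * jac_shift g p)"
  by (cases g; cases p) (auto simp: slash_def Let_def jac_j_def jac_act_def jac_shift_def jac_translate_def)

lemma jac_j_nonzero:
  assumes "g \<in> carrier jacobi_group" "p \<in> jacobi_domain"
  shows "jac_j g p \<noteq> 0"
proof -
  obtain a b c d h where g: "g = ((a, b, c, d), h)" by (metis surj_pair)
  obtain z \<tau> where p: "p = (z, \<tau>)" by (cases p)
  show ?thesis
    using assms by (auto simp: g p jac_j_def jacobi_group_def jacobi_domain_def complex_eq_iff)
qed

lemma Im_jac_act:
  assumes "g \<in> carrier jacobi_group" "p \<in> jacobi_domain"
  shows "Im (snd (jac_act g p)) = Im (snd p) / (norm (jac_j g p))\<^sup>2"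
proof -
  obtain a b c d h where g: "g = ((a, b, c, d), h)" by (metis surj_pair)
  obtain z \<tau> where p: "p = (z, \<tau>)" by (cases p)
  have det: "a * d - b * c = 1" using assms by (simp add: g jacobi_group_def)
  have "a * Im \<tau> * (c * Re \<tau> + d) - (a * Re \<tau> + b) * (c * Im \<tau>) = (a * d - b * c) * Im \<tau>"
    by (simp add: algebra_simps)
  then show ?thesis
    by (simp add: g p jac_act_def jac_j_def Im_divide cmod_power2 det)
qed

lemma cx_bilinear_translate:
  fixes z :: "'a::real_inner cx"
  assumes "w = z + cx_scale \<tau> (cx_of x) + cx_of y"
  shows "cx_bilinear (\<bullet>) w w = cx_bilinear (\<bullet>) z z + 2 * \<tau> * cx_bilinear (\<bullet>) (cx_of x) z
     + \<tau>\<^sup>2 * of_real (x \<bullet> x) + 2 * cx_bilinear (\<bullet>) (cx_of y) z + of_real (y \<bullet> y) + 2 * \<tau> * of_real (x \<bullet> y)"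
  by (simp add: assms cx_bilinear_def cx_scale_def cx_of_def complex_eq_iff inner_simps inner_commute
      power2_eq_square algebra_simps)

lemma jacobi_embed_action:
  fixes g :: "'a::real_inner jac"
  assumes r: "r \<ge> 1" and g: "g \<in> carrier jacobi_group" and p: "p \<in> jacobi_domain"
  shows "J_factor r (jacobi_embed r g) (\<zeta>, p) = jac_j g p"
    and "act r (jacobi_embed r g) (\<zeta>, p) = (\<zeta> + jac_shift g p, jac_act g p)"
proof -
  obtain a b c d x y \<kappa> where g_eq: "g = ((a, b, c, d), (x, y, \<kappa>))" by (metis surj_pair)
  obtain z \<tau> where p_eq: "p = (z, \<tau>)" by (cases p)
  define j where "j = of_real c * \<tau> + of_real d"
  have j: "jac_j g p = j" by (simp add: g_eq p_eq jac_j_def j_def)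
  have "j \<noteq> 0" using jac_j_nonzero[OF g p] by (simp add: j)
  define q where "q = real r * (cx_bilinear (\<bullet>) z z / 2 - \<zeta> * \<tau>)"
  \<comment> \<open>\<open>U\<close>, \<open>U1\<close> and \<open>w\<close> are the coordinates at
    \<open>e\<close>, at \<open>e\<^sub>1\<close> and in \<open>N\<close> after the Heisenberg part
    alone; the coordinates at \<open>f\<^sub>1\<close> and \<open>f\<close> stay
    \<open>\<tau>\<close> and 1.\<close>
  define U where "U = q - of_nat r * (of_real \<kappa> - of_real (x \<bullet> y) / 2) * \<tau>
      + of_nat r * cx_bilinear (\<bullet>) (cx_of y) z + of_nat r * of_real (y \<bullet> y) / 2"
  define U1 where "U1 = \<zeta> + of_real \<kappa> + of_real (x \<bullet> y) / 2 + cx_bilinear (\<bullet>) (cx_of x) z + \<tau> * of_real (x \<bullet> x) / 2"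
  define w where "w = z + cx_scale \<tau> (cx_of x) + cx_of y"
  have w: "jac_translate g p = w" by (simp add: g_eq p_eq jac_translate_def w_def)
  have heis: "map_prod (heis_embed r (x, y, \<kappa>)) (heis_embed r (x, y, \<kappa>)) (tube_embed r (\<zeta>, p))
      = ((Re U, Re U1, fst w, Re \<tau>, 1), (Im U, Im U1, snd w, Im \<tau>, 0))"
    unfolding p_eq tube_embed_eq[OF q_def] map_prod_simp heis_embed_apply[OF r]
    by (simp add: U_def U1_def w_def cx_bilinear_def cx_of_def cx_scale_def inner_simps field_simps)
  have img: "map_prod (jacobi_embed r g) (jacobi_embed r g) (tube_embed r (\<zeta>, p)) =
     ((a * Re U - real r * b * Re U1, - c / real r * Re U + d * Re U1, fst w, a * Re \<tau> + b, c * Re \<tau> + d),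
      (a * Im U - real r * b * Im U1, - c / real r * Im U + d * Im U1, snd w, a * Im \<tau>, c * Im \<tau>))"
  proof -
    have "map_prod (jacobi_embed r g) (jacobi_embed r g) (tube_embed r (\<zeta>, p)) =
      map_prod (SL2_embed r (a, b, c, d)) (SL2_embed r (a, b, c, d))
        (map_prod (heis_embed r (x, y, \<kappa>)) (heis_embed r (x, y, \<kappa>)) (tube_embed r (\<zeta>, p)))"
      by (cases "tube_embed r (\<zeta>, p)") (simp add: g_eq jacobi_embed_def)
    then show ?thesis by (simp add: heis SL2_embed_def)
  qed
  show J: "J_factor r (jacobi_embed r g) (\<zeta>, p) = jac_j g p"
    unfolding j J_factor_def img by (simp add: j_def complex_eq_iff)
  \<comment> \<open>The Heisenberg image is again an embedded point, that of
    \<open>(U1, w, \<tau>)\<close>, so \<open>U\<close> is determined by the other coordinates.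
    Substituting it lets the \<open>r\<close> in the matrix entry \<open>- c / r\<close>
    cancel.\<close>
  have U: "U = of_nat r * (cx_bilinear (\<bullet>) w w / 2 - U1 * \<tau>)"
    unfolding cx_bilinear_translate[OF w_def] U_def U1_def q_def
    by (simp add: power2_eq_square field_simps)
  have "Complex (- c / real r * Re U + d * Re U1) (- c / real r * Im U + d * Im U1) = - (of_real c / of_nat r) * U + of_real d * U1"
    by (simp add: complex_eq_iff)
  also have "\<dots> = j * U1 - of_real c * cx_bilinear (\<bullet>) w w / 2"
    unfolding U using r by (simp add: j_def field_simps)
  finally have e1: "Complex (- c / real r * Re U + d * Re U1) (- c / real r * Im U + d * Im U1)
      = j * U1 - of_real c * cx_bilinear (\<bullet>) w w / 2" .
  have s: "\<zeta> + jac_shift g p = U1 - of_real c * cx_bilinear (\<bullet>) w w / (2 * j)"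
    unfolding jac_shift_def w j by (simp add: g_eq p_eq U1_def mult.commute)
  have "inverse j * (j * U1 - of_real c * cx_bilinear (\<bullet>) w w / 2) = \<zeta> + jac_shift g p"
    unfolding s using \<open>j \<noteq> 0\<close> by (simp add: field_simps)
  moreover have "jac_act g p = (cx_scale (inverse j) w, inverse j * Complex (a * Re \<tau> + b) (a * Im \<tau>))"
    unfolding jac_act_def w j by (simp add: g_eq p_eq complex_eq_iff divide_inverse mult.commute)
  ultimately show "act r (jacobi_embed r g) (\<zeta>, p) = (\<zeta> + jac_shift g p, jac_act g p)"
    unfolding act_def J j img prod.case e1 by (simp add: tube_scale_def)
qed

text \<open>Places the given element of \<open>\<Gamma>\<close> in the Jacobi group as
  \<open>[0, 0; 1]\<close>, so that \<open>jacobi_embed_action\<close> computes its effect on the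
  tube domain.\<close>

lemma translation_eq_jacobi_embed:
  assumes "r \<ge> 1"
  shows "op_exp (wedge r vec_e1 vec_e) = jacobi_embed r ((1, 0, 0, 1), (0, 0, 1))"
proof
  fix u :: "'a MR"
  obtain a b n c d where u: "u = (a, b, n, c, d)" by (metis surj_pair)
  show "op_exp (wedge r vec_e1 vec_e) u = jacobi_embed r ((1, 0, 0, 1), (0, 0, 1)) u"
    using op_exp_e1_e[of 1 r a b n c d]
    by (simp add: u jacobi_embed_def SL2_embed_def heis_embed_apply[OF assms])
qed

lemma bil_add_left: "bil r (x + y) z = bil r x z + bil r y z"
  by (simp add: bil_def split_beta inner_simps algebra_simps)

lemma bil_scaleR_left: "bil r (c *\<^sub>R x) z = c * bil r x z"
  by (simp add: bil_def split_beta inner_simps algebra_simps)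

lemma bil_commute: "bil r x y = bil r y x"
  by (simp add: bil_def split_beta inner_commute algebra_simps)

text \<open>Isotropy of \<open>Z = X + i Y\<close> means that \<open>X\<close> and \<open>Y\<close>
  have equal norms and are orthogonal, so multiplication by \<open>c\<close> rotates and scales
  their plane.\<close>

lemma bil_Im_cx_scale:
  assumes "cx_bilinear (bil r) Z Z = 0"
  shows "bil r (snd (cx_scale c Z)) (snd (cx_scale c Z)) = (norm c)\<^sup>2 * bil r (snd Z) (snd Z)"
proof -
  have add_right: "bil r x (y + z) = bil r x y + bil r x z" for x y z
    using bil_add_left[of r y z x] by (simp add: bil_commute)
  have scale_right: "bil r x (c *\<^sub>R y) = c * bil r x y" for x y c
    using bil_scaleR_left[of r c y x] by (simp add: bil_commute)
  have "bil r (fst Z) (fst Z) = bil r (snd Z) (snd Z)" "bil r (fst Z) (snd Z) = 0"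
    using assms bil_commute[of r "snd Z" "fst Z"] by (auto simp: cx_bilinear_def complex_eq_iff)
  moreover have n: "(norm c)\<^sup>2 = Re c * Re c + Im c * Im c" unfolding cmod_power2 by (simp add: power2_eq_square)
  ultimately show ?thesis
    using bil_commute[of r "snd Z" "fst Z"] unfolding n
    by (simp add: cx_scale_def bil_add_left bil_scaleR_left add_right scale_right algebra_simps)
qed

lemma bil_Im_tube_embed:
  "bil r (snd (tube_embed r (\<zeta>, z, \<tau>))) (snd (tube_embed r (\<zeta>, z, \<tau>))) = real r * (2 * Im \<tau> * Im \<zeta> - snd z \<bullet> snd z)"
  unfolding tube_embed_eq[OF refl] by (simp add: bil_def algebra_simps)

lemma eps_eq:
  assumes "p \<in> jacobi_domain"
  shows "eps \<zeta> p = Im (snd p) / (2 * Im (snd p) * Im \<zeta> - snd (fst p) \<bullet> snd (fst p))"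
  using assms by (auto simp: eps_def ht_def jacobi_domain_def field_simps)

text \<open>The isometry multiplies both \<open>Q\<close>, the form on imaginary parts up to
  \<open>r\<close>, and \<open>Im \<tau>\<close> by the inverse of \<open>(norm j)\<^sup>2\<close>.
  Positivity and the quotient \<open>eps\<close> of the two therefore persist.\<close>

lemma jacobi_tube_invariance:
  fixes g :: "'a::real_inner jac"
  assumes r: "r \<ge> 1" and g: "g \<in> carrier jacobi_group" and mem: "(\<zeta>, p) \<in> tube"
    and iso: "\<And>x y. bil r (jacobi_embed r g x) (jacobi_embed r g y) = bil r x y"
  shows "(\<zeta> + jac_shift g p, jac_act g p) \<in> tube"
    and "eps (\<zeta> + jac_shift g p) (jac_act g p) = eps \<zeta> p"
proof -
  have p: "p \<in> jacobi_domain" using mem by (simp add: tube_iff)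
  define j where "j = jac_j g p"
  have j: "norm j > 0" using jac_j_nonzero[OF g p] by (simp add: j_def)
  define \<gamma> where "\<gamma> = jacobi_embed r g"
  define Q where "Q = (\<lambda>\<zeta> (p :: 'a cx \<times> complex). 2 * Im (snd p) * Im \<zeta> - snd (fst p) \<bullet> snd (fst p))"
  define \<zeta>' where "\<zeta>' = \<zeta> + jac_shift g p"
  define p' where "p' = jac_act g p"
  have Q: "bil r (snd (tube_embed r (\<zeta>, p))) (snd (tube_embed r (\<zeta>, p))) = real r * Q \<zeta> p" for \<zeta> and p :: "'a cx \<times> complex"
    by (cases p) (simp add: bil_Im_tube_embed Q_def)
  have "map_prod \<gamma> \<gamma> (tube_embed r (\<zeta>, p)) = cx_scale j (tube_embed r (\<zeta>', p'))"
    using tube_embed_act[of r \<gamma> "(\<zeta>, p)"] iso jac_j_nonzero[OF g p]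
    by (simp add: \<gamma>_def jacobi_embed_action[OF r g p] j_def \<zeta>'_def p'_def)
  then have img: "\<gamma> (snd (tube_embed r (\<zeta>, p))) = snd (cx_scale j (tube_embed r (\<zeta>', p')))"
    by (metis snd_map_prod)
  have "real r * Q \<zeta> p = bil r (\<gamma> (snd (tube_embed r (\<zeta>, p)))) (\<gamma> (snd (tube_embed r (\<zeta>, p))))"
    by (simp only: Q iso \<gamma>_def)
  also have "\<dots> = (norm j)\<^sup>2 * (real r * Q \<zeta>' p')"
    unfolding img bil_Im_cx_scale[OF tube_embed_isotropic] Q ..
  finally have "real r * Q \<zeta> p = (norm j)\<^sup>2 * (real r * Q \<zeta>' p')" .
  then have QQ: "Q \<zeta> p = (norm j)\<^sup>2 * Q \<zeta>' p'" using r by simp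
  have im: "Im (snd p') = Im (snd p) / (norm j)\<^sup>2"
    unfolding p'_def j_def by (rule Im_jac_act[OF g p])
  have pos: "Im (snd p) > 0" using p by (auto simp: jacobi_domain_def)
  have p': "p' \<in> jacobi_domain"
    using pos j im by (cases p') (simp add: jacobi_domain_def)
  have Q_pos: "Q \<zeta> p > 0 \<longleftrightarrow> (\<zeta>, p) \<in> tube" if "p \<in> jacobi_domain" for \<zeta> p
    using that unfolding tube_iff by (cases p) (auto simp: Q_def ht_def jacobi_domain_def field_simps)
  have "Q \<zeta> p > 0" using Q_pos[OF p] mem by simp
  then have "Q \<zeta>' p' > 0" unfolding QQ using j by (simp add: zero_less_mult_iff)
  then show "(\<zeta> + jac_shift g p, jac_act g p) \<in> tube" using Q_pos[OF p'] by (simp add: \<zeta>'_def p'_def)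
  have "eps \<zeta>' p' = eps \<zeta> p"
    unfolding eps_eq[OF p] eps_eq[OF p'] using QQ im j by (simp add: Q_def)
  then show "eps (\<zeta> + jac_shift g p) (jac_act g p) = eps \<zeta> p" by (simp add: \<zeta>'_def p'_def)
qed


section \<open>Fourier-Jacobi coefficients\<close>

lemma holo_on_cmult:
  assumes "holo_on sc S g"
  shows "holo_on sc S (\<lambda>z. k * g z)"
  unfolding holo_on_def
proof
  fix z assume "z \<in> S"
  then obtain D where D: "(g has_derivative D) (at z)" "\<And>c v. D (sc c v) = c * D v"
    using assms unfolding holo_on_def by blast
  have "((\<lambda>z. k * g z) has_derivative (\<lambda>v. k * D v)) (at z)"
    by (rule has_derivative_mult_right[OF D(1)])
  moreover have "k * D (sc c v) = c * (k * D v)" for c v by (simp add: D(2))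
  ultimately show "\<exists>D. ((\<lambda>z. k * g z) has_derivative D) (at z) \<and> (\<forall>c v. D (sc c v) = c * D v)"
    by blast
qed

text \<open>The \<open>m\<close>-th Fourier coefficient in \<open>\<zeta>\<close>. The height
  \<open>ht p + 1\<close> is one choice that lies in the fibre over every \<open>p\<close>.\<close>

definition fcoef :: "int \<Rightarrow> ('a::real_inner tube_pt \<Rightarrow> complex) \<Rightarrow> 'a cx \<times> complex \<Rightarrow> complex" where
  "fcoef m c p = integral {0..1} (\<lambda>t. c (\<i> * of_real (ht p + 1) + of_real t, p) *
     e_exp (- of_int m * (\<i> * of_real (ht p + 1) + of_real t)))"

lemma fcoef_cong:
  assumes "\<And>z. z \<in> tube \<Longrightarrow> c z = d z" "p \<in> jacobi_domain"
  shows "fcoef m c p = fcoef m d p"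
proof -
  have "c (\<i> * of_real (ht p + 1) + of_real t, p) = d (\<i> * of_real (ht p + 1) + of_real t, p)" for t
    by (rule assms(1)) (use assms(2) in \<open>simp add: tube_iff\<close>)
  then show ?thesis by (simp add: fcoef_def)
qed

lemma tube_slice_holomorphic:
  assumes "holo_on tube_scale tube c" "p \<in> jacobi_domain"
  shows "(\<lambda>\<zeta>. c (\<zeta>, p)) holomorphic_on {\<zeta>. Im \<zeta> > ht p}"
proof -
  have *: "(0, p) + tube_scale \<zeta> (1, 0, 0) = (\<zeta>, p)" for \<zeta>
    by (cases p) (simp add: tube_scale_def cx_scale_def zero_prod_def)
  have "(\<lambda>\<zeta>. c ((0, p) + tube_scale \<zeta> (1, 0, 0))) holomorphic_on {\<zeta>. Im \<zeta> > ht p}"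
    by (rule holo_on_line_holomorphic[OF assms(1) bounded_linear_tube_scale])
       (use assms(2) in \<open>simp only: * tube_iff, simp\<close>)
  then show ?thesis by (simp only: *)
qed

section \<open>Fourier expansion of a single periodic holomorphic function\<close>

context
  fixes c :: "'a::real_inner tube_pt \<Rightarrow> complex"
  assumes c: "holo_on tube_scale tube c"
    and per: "\<And>\<zeta> p. (\<zeta>, p) \<in> tube \<Longrightarrow> c (\<zeta> + 1, p) = c (\<zeta>, p)"
begin

lemma fcoef_eq_integral:
  assumes "(\<zeta>, p) \<in> tube"
  shows "integral {0..1} (\<lambda>t. c (\<zeta> + of_real t, p) * e_exp (- of_int m * (\<zeta> + of_real t))) = fcoef m c p"
  unfolding fcoef_def
proof (rule unit_integral_periodic[where S = "{\<zeta>. Im \<zeta> > ht p}"])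
  have p: "p \<in> jacobi_domain" and \<zeta>: "Im \<zeta> > ht p" using assms by (simp_all add: tube_iff)
  show "(\<lambda>x. c (x, p) * e_exp (- of_int m * x)) holomorphic_on {\<zeta>. Im \<zeta> > ht p}"
    by (intro holomorphic_intros tube_slice_holomorphic c p)
  show "c (x + 1, p) * e_exp (- of_int m * (x + 1)) = c (x, p) * e_exp (- of_int m * x)"
    if "x \<in> {\<zeta>. Im \<zeta> > ht p}" for x
    using per[of x p] that p e_exp_add[of "- of_int m * x" "of_int (- m)"] by (simp add: tube_iff distrib_left)
qed (use assms in \<open>auto simp: tube_iff convex_halfspace_Im_gt open_halfspace_Im_gt\<close>)

lemma fcoef_has_sum:
  assumes "(\<zeta>, p) \<in> tube"
  shows "((\<lambda>m. e_exp (of_int m * \<zeta>) * fcoef m c p) has_sum c (\<zeta>, p)) UNIV"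
  unfolding fcoef_def
  by (rule fourier_half_plane[where a = "ht p" and h = "\<lambda>\<zeta>. c (\<zeta>, p)"])
     (use assms c in \<open>auto simp: tube_iff per intro!: tube_slice_holomorphic\<close>)

text \<open>The height \<open>ht p + 1\<close> of the path is not holomorphic in \<open>p\<close>.
  Near \<open>p0\<close> the path is therefore replaced by the one starting at the fixed point
  \<open>\<zeta>0\<close>, and \<open>holo_on_integral\<close> applies.\<close>

lemma holo_on_fcoef: "holo_on jac_scale jacobi_domain (fcoef m c)"
  unfolding holo_on_def
proof
  fix p0 :: "'a cx \<times> complex" assume p0: "p0 \<in> jacobi_domain"
  define \<zeta>0 where "\<zeta>0 = \<i> * of_real (ht p0 + 1)"
  define U where "U = Pair \<zeta>0 -` (tube :: 'a tube_pt set)"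
  have U: "open U" unfolding U_def
    by (intro open_vimage open_tube continuous_intros)
  have mem: "p0 \<in> U" using p0 by (simp add: U_def \<zeta>0_def tube_iff)
  have shift: "(\<zeta>0 + of_real t, p) \<in> tube" if "p \<in> U" for p t
    using that by (simp add: U_def tube_iff)
  define g where "g = (\<lambda>p t. c (\<zeta>0 + of_real t, p) * e_exp (- of_int m * (\<zeta>0 + of_real t)))"
  have "holo_on jac_scale U (\<lambda>p. integral {0..1} (g p))"
  proof (rule holo_on_integral[OF U])
    show "holo_on jac_scale U (\<lambda>p. g p t)" for t
      unfolding holo_on_def
    proof
      fix p assume "p \<in> U"
      then obtain D where D: "(c has_derivative D) (at (\<zeta>0 + of_real t, p))" "\<And>a v. D (tube_scale a v) = a * D v"
        using c shift unfolding holo_on_def by blast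
      have "((\<lambda>p. (\<zeta>0 + of_real t, p)) has_derivative (\<lambda>h. (0, h))) (at p)"
        by (auto intro!: derivative_eq_intros)
      from has_derivative_compose[OF this D(1)]
      have "((\<lambda>p. g p t) has_derivative (\<lambda>h. D (0, h) * e_exp (- of_int m * (\<zeta>0 + of_real t)))) (at p)"
        unfolding g_def by (rule has_derivative_mult_left)
      moreover have "D (0, jac_scale a v) = a * D (0, v)" for a v
        using D(2)[of a "(0, v)"] by (simp add: tube_scale_def jac_scale_def split_beta)
      ultimately show "\<exists>D. ((\<lambda>p. g p t) has_derivative D) (at p) \<and> (\<forall>a v. D (jac_scale a v) = a * D v)"
        by (intro exI conjI) (assumption, simp)
    qed
    have "continuous_on (U \<times> UNIV) (\<lambda>x. c (\<zeta>0 + of_real (snd x), fst x) * e_exp (- of_int m * (\<zeta>0 + of_real (snd x))))"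
      by (intro continuous_intros continuous_on_compose2[OF holo_on_imp_continuous_on[OF c]]) (auto intro: shift)
    then show "continuous_on (U \<times> UNIV) (\<lambda>(p, t). g p t)" by (simp add: g_def split_beta)
  qed
  then obtain D where D: "((\<lambda>p. integral {0..1} (g p)) has_derivative D) (at p0)" "\<forall>a v. D (jac_scale a v) = a * D v"
    using mem unfolding holo_on_def by blast
  have "(fcoef m c has_derivative D) (at p0)"
  proof (rule has_derivative_transform_within_open[OF D(1) U mem])
    show "integral {0..1} (g p) = fcoef m c p" if "p \<in> U" for p
      unfolding g_def by (rule fcoef_eq_integral) (use that in \<open>simp add: U_def\<close>)
  qed
  then show "\<exists>D. (fcoef m c has_derivative D) (at p0) \<and> (\<forall>a v. D (jac_scale a v) = a * D v)"
    using D(2) by blast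
qed

end

text \<open>For \<open>e > 0\<close> the \<open>m\<close>-th Fourier coefficient of \<open>F\<close>
  along the horizontal line with \<open>eps = e\<close>. Its value at \<open>e = 0\<close> will be
  the almost-holomorphic Jacobi form.\<close>

definition limit_coeff ::
  "int \<Rightarrow> ('a::real_inner tube_pt multiset \<Rightarrow> 'a tube_pt \<Rightarrow> complex) \<Rightarrow> 'a tube_pt multiset set \<Rightarrow>
   real \<Rightarrow> 'a cx \<times> complex \<Rightarrow> complex" where
  "limit_coeff m c \<A> e p = (\<Sum>A\<in>\<A>. fcoef m (c A) p * (\<Prod>j\<in>#A. nu_at j e p))"

lemma tendsto_limit_coeff: "((\<lambda>e. limit_coeff m c \<A> e p) \<longlongrightarrow> limit_coeff m c \<A> 0 p) (at_right 0)"
proof -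
  have "((\<lambda>e. \<Prod>j\<in>#A. nu_at j e p) \<longlongrightarrow> (\<Prod>j\<in>#A. nu_at j 0 p)) (at_right 0)" for A
  proof (induction A)
    case (add j A)
    have "((\<lambda>e. nu_at j e p) \<longlongrightarrow> nu_at j 0 p) (at_right 0)"
      unfolding nu_at_def by (intro tendsto_intros)
    from tendsto_mult[OF this add.IH] show ?case by simp
  qed simp
  then show ?thesis unfolding limit_coeff_def by (intro tendsto_intros)
qed

text \<open>Real translation of \<open>\<zeta>\<close> preserves \<open>eps\<close>, so the
  \<nu>-monomials are constant along the path and leave the integral.\<close>

lemma integral_eq_limit_coeff:
  fixes F :: "'a::real_inner tube_pt \<Rightarrow> complex"
  assumes r: "r \<ge> 1" and c: "\<And>A. A \<in> \<A> \<Longrightarrow> set_mset A \<subseteq> tube_basis B \<and> holo_on tube_scale tube (c A)"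
    and per: "\<And>A \<zeta> p. A \<in> \<A> \<Longrightarrow> (\<zeta>, p) \<in> tube \<Longrightarrow> c A (\<zeta> + 1, p) = c A (\<zeta>, p)"
    and F: "\<And>z. z \<in> tube \<Longrightarrow> F z = (\<Sum>A\<in>\<A>. c A z * (\<Prod>j\<in>#A. \<nu>_fun r j z))"
    and fin: "finite \<A>" and mem: "(\<zeta>, p) \<in> tube"
  shows "integral {0..1} (\<lambda>t. F (\<zeta> + of_real t, p) * e_exp (- of_int m * (\<zeta> + of_real t)))
     = limit_coeff m c \<A> (eps \<zeta> p) p"
proof -
  have mem_t: "(\<zeta> + of_real t, p) \<in> tube" for t using mem by (simp add: tube_iff)
  have eps_t: "eps (\<zeta> + of_real t) p = eps \<zeta> p" for t by (simp add: eps_def)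
  have prod: "(\<Prod>j\<in>#A. \<nu>_fun r j (\<zeta> + of_real t, p)) = (\<Prod>j\<in>#A. nu_at j (eps \<zeta> p) p)" if "A \<in> \<A>" for A t
    using c[OF that] \<nu>_fun_basis[OF r mem_t, where B = B]
    by (intro arg_cong[of _ _ prod_mset] image_mset_cong) (auto simp: eps_t)
  have int: "(\<lambda>t. c A (\<zeta> + of_real t, p) * e_exp (- of_int m * (\<zeta> + of_real t))) integrable_on {0..1}" if "A \<in> \<A>" for A
    using c[OF that] mem_t
    by (intro integrable_continuous_real continuous_intros
        continuous_on_compose2[OF holo_on_imp_continuous_on[of tube_scale tube "c A"]]) auto
  have "integral {0..1} (\<lambda>t. F (\<zeta> + of_real t, p) * e_exp (- of_int m * (\<zeta> + of_real t)))
    = integral {0..1} (\<lambda>t. \<Sum>A\<in>\<A>. (\<Prod>j\<in>#A. nu_at j (eps \<zeta> p) p) *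
        (c A (\<zeta> + of_real t, p) * e_exp (- of_int m * (\<zeta> + of_real t))))"
    by (intro integral_cong) (simp add: F[OF mem_t] prod sum_distrib_left mult_ac)
  also have "\<dots> = (\<Sum>A\<in>\<A>. integral {0..1} (\<lambda>t. (\<Prod>j\<in>#A. nu_at j (eps \<zeta> p) p) *
        (c A (\<zeta> + of_real t, p) * e_exp (- of_int m * (\<zeta> + of_real t)))))"
    by (intro integral_sum fin integrable_on_mult_right int)
  also have "\<dots> = (\<Sum>A\<in>\<A>. (\<Prod>j\<in>#A. nu_at j (eps \<zeta> p) p) * fcoef m (c A) p)"
    unfolding integral_mult_right
    using c per mem by (intro sum.cong refl arg_cong2[where f = "(*)"] fcoef_eq_integral) auto
  finally show ?thesis by (simp add: limit_coeff_def mult.commute)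
qed

text \<open>For fixed \<open>e > 0\<close> the element \<open>g\<close> maps one path with
  \<open>eps = e\<close> to another, so the transformation of \<open>F\<close> can be integrated
  pointwise. The law then passes to the limit.\<close>

lemma slash_limit_coeff:
  fixes F :: "'a::real_inner tube_pt \<Rightarrow> complex"
  assumes r: "r \<ge> 1" and c: "\<And>A. A \<in> \<A> \<Longrightarrow> set_mset A \<subseteq> tube_basis B \<and> holo_on tube_scale tube (c A)"
    and per: "\<And>A \<zeta> p. A \<in> \<A> \<Longrightarrow> (\<zeta>, p) \<in> tube \<Longrightarrow> c A (\<zeta> + 1, p) = c A (\<zeta>, p)"
    and F: "\<And>z. z \<in> tube \<Longrightarrow> F z = (\<Sum>A\<in>\<A>. c A z * (\<Prod>j\<in>#A. \<nu>_fun r j z))"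
    and fin: "finite \<A>" and p: "p \<in> jacobi_domain" and g: "g \<in> carrier jacobi_group"
    and iso: "\<And>x y. bil r (jacobi_embed r g x) (jacobi_embed r g y) = bil r x y"
    and inv: "\<And>z. z \<in> tube \<Longrightarrow>
      F (act r (jacobi_embed r g) z) = J_factor r (jacobi_embed r g) z powi k * F z"
  shows "slash k m g (limit_coeff m c \<A> 0) p = limit_coeff m c \<A> 0 p"
proof -
  define p' where "p' = jac_act g p"
  define s where "s = jac_shift g p"
  define j where "j = jac_j g p"
  have j: "j \<noteq> 0" using jac_j_nonzero[OF g p] by (simp add: j_def)
  have int: "integral {0..1} (\<lambda>t. F (\<zeta> + of_real t, p) * e_exp (- of_int m * (\<zeta> + of_real t)))
      = limit_coeff m c \<A> (eps \<zeta> p) p" if "(\<zeta>, p) \<in> tube" for \<zeta> p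
    by (rule integral_eq_limit_coeff[where B = B]) (fact r c per F fin that)+
  have eq: "limit_coeff m c \<A> e p' = j powi k * e_exp (- of_int m * s) * limit_coeff m c \<A> e p" if "e > 0" for e
  proof -
    \<comment> \<open>The height in the fibre over \<open>p\<close> at which \<open>eps\<close>
      equals \<open>e\<close>.\<close>
    define \<zeta> where "\<zeta> = \<i> * of_real (ht p + 1 / (2 * e))"
    have mem: "(\<zeta>, p) \<in> tube" using p that by (simp add: tube_iff \<zeta>_def)
    then have mem_t: "(\<zeta> + of_real t, p) \<in> tube" for t by (simp add: tube_iff)
    have e: "eps \<zeta> p = e" using that by (simp add: eps_def \<zeta>_def)
    have mem': "(\<zeta> + s, p') \<in> tube" and e': "eps (\<zeta> + s) p' = e"
      using jacobi_tube_invariance[OF r g mem iso] e by (simp_all add: s_def p'_def)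
    have "limit_coeff m c \<A> e p' = integral {0..1} (\<lambda>t. F (\<zeta> + s + of_real t, p') * e_exp (- of_int m * (\<zeta> + s + of_real t)))"
      unfolding int[OF mem'] e' ..
    also have "\<dots> = integral {0..1} (\<lambda>t. (j powi k * e_exp (- of_int m * s)) *
        (F (\<zeta> + of_real t, p) * e_exp (- of_int m * (\<zeta> + of_real t))))"
    proof (rule integral_cong)
      fix t :: real
      have "F (\<zeta> + of_real t + s, p') = j powi k * F (\<zeta> + of_real t, p)"
        using inv[OF mem_t[of t]] by (simp add: jacobi_embed_action[OF r g p] s_def p'_def j_def)
      moreover have "e_exp (- of_int m * (\<zeta> + s + of_real t)) = e_exp (- of_int m * s) * e_exp (- of_int m * (\<zeta> + of_real t))"
        by (simp only: e_exp_add[symmetric]) (simp add: algebra_simps)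
      ultimately show "F (\<zeta> + s + of_real t, p') * e_exp (- of_int m * (\<zeta> + s + of_real t)) =
          (j powi k * e_exp (- of_int m * s)) * (F (\<zeta> + of_real t, p) * e_exp (- of_int m * (\<zeta> + of_real t)))"
        by (simp add: add_ac mult_ac)
    qed
    also have "\<dots> = (j powi k * e_exp (- of_int m * s)) * limit_coeff m c \<A> e p"
      unfolding integral_mult_right int[OF mem] e ..
    finally show ?thesis .
  qed
  \<comment> \<open>The case \<open>e = 0\<close> lies outside the tube domain and is reached by
    continuity of the polynomials in \<open>e\<close> on both sides.\<close>
  have "limit_coeff m c \<A> 0 p' = j powi k * e_exp (- of_int m * s) * limit_coeff m c \<A> 0 p"
  proof (rule tendsto_unique[OF _ tendsto_limit_coeff])
    show "((\<lambda>e. limit_coeff m c \<A> e p') \<longlongrightarrow> j powi k * e_exp (- of_int m * s) * limit_coeff m c \<A> 0 p) (at_right 0)"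
    proof (rule Lim_transform_eventually)
      show "((\<lambda>e. j powi k * e_exp (- of_int m * s) * limit_coeff m c \<A> e p)
          \<longlongrightarrow> j powi k * e_exp (- of_int m * s) * limit_coeff m c \<A> 0 p) (at_right 0)"
        by (intro tendsto_intros tendsto_limit_coeff)
      show "\<forall>\<^sub>F e in at_right 0. j powi k * e_exp (- of_int m * s) * limit_coeff m c \<A> e p = limit_coeff m c \<A> e p'"
        using eventually_at_right_less[of 0] by eventually_elim (simp add: eq)
    qed
  qed simp
  moreover have "e_exp (- of_int m * s) * e_exp (of_int m * s) = 1"
    by (simp add: e_exp_add[symmetric])
  moreover have "j powi (- k) * j powi k = 1" using j by (simp add: power_int_minus)
  ultimately show ?thesis
    unfolding slash_eq p'_def[symmetric] s_def[symmetric] j_def[symmetric]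
    by (metis (no_types, lifting) mult.assoc mult.commute mult.right_neutral)
qed

lemma nu_at_0:
  assumes "v \<in> tube_basis B"
  shows "nu_at v 0 p = (if v = (0, 0, 1) then - \<i> / 2 * of_real (1 / Im (snd p)) else 0)"
  using assms by (auto simp: nu_at_def tube_basis_def)

text \<open>At \<open>e = 0\<close> only \<nu> in the direction \<open>(0, 0, 1)\<close> survives,
  with value \<open>- \<i> / 2\<close> times \<open>1 / Im \<tau>\<close>. A multiset of
  \<open>n\<close> copies of \<open>None\<close> thus receives the coefficient of its
  \<open>n\<close>-th power, and monomials containing some \<open>Some b\<close> receive 0.\<close>

definition boundary_coeff ::
  "int \<Rightarrow> ('a::real_inner tube_pt multiset \<Rightarrow> 'a tube_pt \<Rightarrow> complex) \<Rightarrow>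
   'a option multiset \<Rightarrow> 'a cx \<times> complex \<Rightarrow> complex" where
  "boundary_coeff m c X p = (if set_mset X \<subseteq> {None}
     then (- \<i> / 2) ^ size X * fcoef m (c (replicate_mset (size X) (0, 0, 1))) p else 0)"

lemma poly_expansion_limit_coeff:
  fixes c :: "'a::real_inner tube_pt multiset \<Rightarrow> 'a tube_pt \<Rightarrow> complex"
  assumes c: "\<And>A. A \<in> \<A> \<Longrightarrow> set_mset A \<subseteq> tube_basis B \<and> holo_on tube_scale tube (c A)"
    and c0: "\<And>A z. A \<notin> \<A> \<Longrightarrow> z \<in> tube \<Longrightarrow> c A z = 0"
    and per: "\<And>A \<zeta> p. A \<in> \<A> \<Longrightarrow> (\<zeta>, p) \<in> tube \<Longrightarrow> c A (\<zeta> + 1, p) = c A (\<zeta>, p)"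
    and fin: "finite \<A>"
  shows "poly_expansion jac_scale jacobi_domain (insert None (Some ` B)) (jacobi_var B)
     (boundary_coeff m c) (limit_coeff m c \<A> 0)"
  unfolding poly_expansion_def
proof (intro exI conjI ballI allI impI)
  let ?v = "(0, 0, 1) :: 'a tube_pt"
  \<comment> \<open>The pure powers of \<nu> in the direction \<open>?v\<close>, which are the
    monomials surviving at \<open>e = 0\<close>; \<open>h\<close> translates them into powers of
    \<open>1 / Im \<tau>\<close>.\<close>
  define \<A>0 where "\<A>0 = {A \<in> \<A>. set_mset A \<subseteq> {?v}}"
  define h where "h = (\<lambda>A :: 'a tube_pt multiset. replicate_mset (size A) (None :: 'a option))"
  have rep: "A = replicate_mset (size A) ?v" if "A \<in> \<A>0" for A
    using that by (intro set_mset_subset_singletonD) (simp add: \<A>0_def)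
  have inj: "inj_on h \<A>0"
  proof (rule inj_onI)
    fix A A' assume *: "A \<in> \<A>0" "A' \<in> \<A>0" "h A = h A'"
    then have "size A = size A'" by (metis h_def size_replicate_mset)
    then show "A = A'" using rep[OF *(1)] rep[OF *(2)] by simp
  qed
  show "finite (h ` \<A>0)" using fin by (simp add: \<A>0_def)
  have bc: "boundary_coeff m c (h A) p = (- \<i> / 2) ^ size A * fcoef m (c A) p" if "A \<in> \<A>0" for A p
    using rep[OF that] by (simp add: boundary_coeff_def h_def)
  fix X
  show "set_mset X \<subseteq> insert None (Some ` B)" if "X \<in> h ` \<A>0"
    using that by (auto simp: h_def split: if_splits)
  show "holo_on jac_scale jacobi_domain (boundary_coeff m c X)" if "X \<in> h ` \<A>0"
  proof -
    obtain A where A: "A \<in> \<A>0" "X = h A" using \<open>X \<in> h ` \<A>0\<close> by blast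
    then have "A \<in> \<A>" by (simp add: \<A>0_def)
    then have "holo_on jac_scale jacobi_domain (fcoef m (c A))"
      using c per by (intro holo_on_fcoef) auto
    then have "holo_on jac_scale jacobi_domain (\<lambda>p. (- \<i> / 2) ^ size A * fcoef m (c A) p)"
      by (rule holo_on_cmult)
    then show ?thesis by (simp add: A(2) bc[OF A(1), abs_def])
  qed
  \<comment> \<open>If \<open>X\<close> is a power of \<open>None\<close> outside the image, the
    matching coefficient of \<open>F\<close> lies outside \<open>\<A>\<close> and is zero on the
    tube domain, though perhaps not elsewhere; hence \<open>fcoef_cong\<close>.\<close>
  show "boundary_coeff m c X p = 0" if "X \<notin> h ` \<A>0" "p \<in> jacobi_domain" for p
  proof (cases "set_mset X \<subseteq> {None}")
    case True
    then have X: "X = replicate_mset (size X) None" by (rule set_mset_subset_singletonD)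
    have "replicate_mset (size X) ?v \<notin> \<A>"
    proof
      assume "replicate_mset (size X) ?v \<in> \<A>"
      then have "replicate_mset (size X) ?v \<in> \<A>0" by (auto simp: \<A>0_def)
      then show False using that(1) X by (auto simp: h_def image_iff)
    qed
    then have "fcoef m (c (replicate_mset (size X) ?v)) p = fcoef m (\<lambda>_. 0) p"
      using c0 that(2) by (intro fcoef_cong) auto
    then show ?thesis by (simp add: boundary_coeff_def fcoef_def)
  qed (simp add: boundary_coeff_def)
  fix p :: "'a cx \<times> complex"
  assume p: "p \<in> jacobi_domain"
  have "limit_coeff m c \<A> 0 p = (\<Sum>A\<in>\<A>0. fcoef m (c A) p * (\<Prod>j\<in>#A. nu_at j 0 p))"
    unfolding limit_coeff_def
  proof (rule sum.mono_neutral_right[OF fin])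
    show "\<forall>A\<in>\<A> - \<A>0. fcoef m (c A) p * (\<Prod>j\<in>#A. nu_at j 0 p) = 0"
    proof
      fix A assume A: "A \<in> \<A> - \<A>0"
      then have "A \<in> \<A>" "\<not> set_mset A \<subseteq> {?v}" by (simp_all add: \<A>0_def)
      then obtain j where "j \<in># A" "j \<noteq> ?v" "j \<in> tube_basis B" using c by blast
      then have "nu_at j 0 p = 0" by (simp add: nu_at_0)
      with \<open>j \<in># A\<close> show "fcoef m (c A) p * (\<Prod>j\<in>#A. nu_at j 0 p) = 0" by (auto simp: prod_mset_zero_iff)
    qed
  qed (auto simp: \<A>0_def)
  also have "\<dots> = (\<Sum>A\<in>\<A>0. boundary_coeff m c (h A) p * (\<Prod>j\<in>#h A. jacobi_var B j p))"
  proof (rule sum.cong)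
    fix A assume A: "A \<in> \<A>0"
    have "(\<Prod>j\<in>#A. nu_at j 0 p) = nu_at ?v 0 p ^ size A"
      by (subst rep[OF A]) simp
    also have "nu_at ?v 0 p = - \<i> / 2 * of_real (1 / Im (snd p))"
      by (subst nu_at_0[where B = B]) (simp_all add: tube_basis_def)
    also have "of_real (1 / Im (snd p)) = jacobi_var B None p"
      by (simp add: jacobi_var_def split_beta)
    also have "(- \<i> / 2 * jacobi_var B None p) ^ size A = (- \<i> / 2) ^ size A * jacobi_var B None p ^ size A"
      by (rule power_mult_distrib)
    finally show "fcoef m (c A) p * (\<Prod>j\<in>#A. nu_at j 0 p) = boundary_coeff m c (h A) p * (\<Prod>j\<in>#h A. jacobi_var B j p)"
      unfolding bc[OF A] by (simp add: h_def)
  qed simp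
  also have "\<dots> = (\<Sum>X\<in>h ` \<A>0. boundary_coeff m c X p * (\<Prod>j\<in>#X. jacobi_var B j p))"
    by (simp add: sum.reindex[OF inj])
  finally show "limit_coeff m c \<A> 0 p = (\<Sum>X\<in>h ` \<A>0. boundary_coeff m c X p * (\<Prod>j\<in>#X. jacobi_var B j p))" .
qed

text \<open>Both \<open>F\<close> and the \<nu>-functions are invariant under the translation. The
  differences of the translated and original coefficients thus satisfy a polynomial relation in the
  \<nu>-functions and vanish by \<open>\<nu>_fun_independent\<close>.\<close>

lemma coefficients_periodic:
  fixes c :: "'a::real_inner tube_pt multiset \<Rightarrow> 'a tube_pt \<Rightarrow> complex"
  assumes r: "r \<ge> 1" and B: "finite B" "independent B"
    and c: "\<And>A. A \<in> \<A> \<Longrightarrow> set_mset A \<subseteq> tube_basis B \<and> holo_on tube_scale tube (c A)"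
    and F: "\<And>z. z \<in> tube \<Longrightarrow> F z = (\<Sum>A\<in>\<A>. c A z * (\<Prod>j\<in>#A. \<nu>_fun r j z))"
    and fin: "finite \<A>" and per: "\<And>\<zeta> p. (\<zeta>, p) \<in> tube \<Longrightarrow> F (\<zeta> + 1, p) = F (\<zeta>, p)"
    and A: "A \<in> \<A>" and mem: "(\<zeta>, p) \<in> tube"
  shows "c A (\<zeta> + 1, p) = c A (\<zeta>, p)"
proof -
  define e :: "'a tube_pt" where "e = (1, 0)"
  have e: "(\<zeta>, p) + e = (\<zeta> + 1, p)" for \<zeta> p by (simp add: e_def)
  have e_tube: "z + e \<in> tube" if "z \<in> tube" for z
    using that by (cases z) (simp add: e_def tube_iff)
  have nu: "\<nu>_fun r j (z + e) = \<nu>_fun r j z" if "j \<in> tube_basis B" "z \<in> tube" for j z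
    using \<nu>_fun_basis[OF r, of "fst z + 1" "snd z" j B] \<nu>_fun_basis[OF r, of "fst z" "snd z" j B] that e_tube[OF that(2)]
    by (cases z) (simp add: e_def eps_def)
  have "c A ((\<zeta>, p) + e) - c A (\<zeta>, p) = 0"
  proof (rule \<nu>_fun_independent[OF r B fin _ _ A mem, where d = "\<lambda>A z. c A (z + e) - c A z"])
    show "set_mset A \<subseteq> tube_basis B \<and> holo_on tube_scale tube (\<lambda>z. c A (z + e) - c A z)" if A: "A \<in> \<A>" for A
    proof (intro conjI)
      show "set_mset A \<subseteq> tube_basis B" using c[OF A] by simp
      show "holo_on tube_scale tube (\<lambda>z. c A (z + e) - c A z)"
        unfolding holo_on_def
      proof
        fix z :: "'a tube_pt" assume z: "z \<in> tube"
        obtain D where D: "(c A has_derivative D) (at z)" "\<And>a v. D (tube_scale a v) = a * D v"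
          using c[OF A] z unfolding holo_on_def by blast
        obtain D' where D': "(c A has_derivative D') (at (z + e))" "\<And>a v. D' (tube_scale a v) = a * D' v"
          using c[OF A] e_tube[OF z] unfolding holo_on_def by blast
        have "((\<lambda>z. z + e) has_derivative (\<lambda>h. h)) (at z)" by (auto intro!: derivative_eq_intros)
        from has_derivative_diff[OF has_derivative_compose[OF this D'(1)] D(1)]
        show "\<exists>D. ((\<lambda>z. c A (z + e) - c A z) has_derivative D) (at z) \<and> (\<forall>a v. D (tube_scale a v) = a * D v)"
          by (intro exI conjI) (assumption, simp add: D(2) D'(2) right_diff_distrib)
      qed
    qed
    fix z :: "'a tube_pt" assume z: "z \<in> tube"
    have "(\<Sum>A\<in>\<A>. c A (z + e) * (\<Prod>j\<in>#A. \<nu>_fun r j z)) = (\<Sum>A\<in>\<A>. c A (z + e) * (\<Prod>j\<in>#A. \<nu>_fun r j (z + e)))"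
    proof (rule sum.cong)
      fix A assume "A \<in> \<A>"
      then have "(\<Prod>j\<in>#A. \<nu>_fun r j z) = (\<Prod>j\<in>#A. \<nu>_fun r j (z + e))"
        using c[of A] nu[OF _ z] by (intro arg_cong[of _ _ prod_mset] image_mset_cong) auto
      then show "c A (z + e) * (\<Prod>j\<in>#A. \<nu>_fun r j z) = c A (z + e) * (\<Prod>j\<in>#A. \<nu>_fun r j (z + e))"
        by simp
    qed simp
    also have "\<dots> = (\<Sum>A\<in>\<A>. c A z * (\<Prod>j\<in>#A. \<nu>_fun r j z))"
      using F[OF e_tube[OF z]] F[OF z] per[of "fst z" "snd z"] z by (cases z) (simp add: e_def)
    finally show "(\<Sum>A\<in>\<A>. (c A (z + e) - c A z) * (\<Prod>j\<in>#A. \<nu>_fun r j z)) = 0"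
      by (simp add: left_diff_distrib sum_subtractf)
  qed
  then show ?thesis by (simp add: e)
qed

theorem theorem1p6:
  fixes B :: "'a::real_inner set" and r :: nat and k :: int
    and \<Gamma> :: "('a MR \<Rightarrow> 'a MR) set" and f :: "'a tube_pt \<Rightarrow> complex"
  assumes "r \<ge> 1"
    and "even_lattice_basis B"
    and "finite_index_subgroup \<Gamma> (O_plus r B)"
    and "op_exp (wedge r vec_e1 vec_e) \<in> \<Gamma>"
    and "f \<in> QMod0 r B k \<Gamma>"
  shows "\<exists>fm :: int \<Rightarrow> 'a cx \<times> complex \<Rightarrow> complex.
           (\<forall>(\<tau>', z, \<tau>) \<in> tube.
              ((\<lambda>m. e_exp (of_int m * \<tau>') * fm m (z, \<tau>)) has_sum f (\<tau>', z, \<tau>)) UNIV) \<and>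
           (\<forall>m. weak_quasi_jacobi B k m (inter_jacobi r \<Gamma>) (fm m))"
proof -
  note r = \<open>r \<ge> 1\<close>
  have B: "finite B" "independent B" using assms(2) by (auto simp: even_lattice_basis_def)
  have \<Gamma>: "\<Gamma> \<subseteq> O_plus_R r"
    using subgroup.subset[of \<Gamma> "O_plus r B"] assms(3) by (auto simp: finite_index_subgroup_def O_plus_def)
  obtain F c where inv: "\<And>\<gamma> z. \<gamma> \<in> \<Gamma> \<Longrightarrow> z \<in> tube \<Longrightarrow> F (act r \<gamma> z) = J_factor r \<gamma> z powi k * F z"
    and pe: "poly_expansion tube_scale tube (tube_basis B) (\<nu>_fun r) c F"
    and f: "\<And>z. z \<in> tube \<Longrightarrow> f z = c {#} z"
    using assms(5) unfolding QMod0_def by blast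
  obtain \<A> where fin: "finite \<A>"
    and pe: "\<forall>A\<in>\<A>. set_mset A \<subseteq> tube_basis B \<and> holo_on tube_scale tube (c A)"
      "\<forall>A. A \<notin> \<A> \<longrightarrow> (\<forall>z\<in>tube. c A z = 0)"
      "\<forall>z\<in>tube. F z = (\<Sum>A\<in>\<A>. c A z * (\<Prod>j\<in>#A. \<nu>_fun r j z))"
    using pe unfolding poly_expansion_def by (elim exE conjE) (rule that; assumption)
  note c = bspec[OF pe(1)] and c0 = pe(2)[rule_format] and F = bspec[OF pe(3)]
  \<comment> \<open>This element has automorphy factor 1, displacement 1 and trivial action on
    \<open>p\<close>, so invariance of \<open>F\<close> under it is plain periodicity.\<close>
  let ?g = "((1, 0, 0, 1), (0, 0, 1)) :: 'a jac"
  have g: "?g \<in> carrier jacobi_group" by (simp add: jacobi_group_def)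
  have j1: "jac_j ?g p = 1" and tr: "jac_translate ?g p = fst p" for p
    by (simp_all add: jac_j_def jac_translate_def cx_scale_def cx_of_def zero_prod_def[symmetric] split_beta)
  have shift: "jac_shift ?g p = 1" for p
    by (simp add: jac_shift_def cx_bilinear_def cx_of_def complex_eq_iff)
  have act: "jac_act ?g p = p" for p
    by (simp add: jac_act_def j1 tr cx_scale_def)
  have F_per: "F (\<zeta> + 1, p) = F (\<zeta>, p)" if mem: "(\<zeta>, p) \<in> tube" for \<zeta> p
  proof -
    have p: "p \<in> jacobi_domain" using mem by (simp add: tube_iff)
    have "jacobi_embed r ?g \<in> \<Gamma>" using assms(4) by (simp add: translation_eq_jacobi_embed[OF r])
    from inv[OF this mem] show ?thesis
      by (simp add: jacobi_embed_action[OF r g p] j1 shift act)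
  qed
  have per: "c A (\<zeta> + 1, p) = c A (\<zeta>, p)" if "A \<in> \<A>" "(\<zeta>, p) \<in> tube" for A \<zeta> p
    by (rule coefficients_periodic[OF r B c F fin F_per that])
  \<comment> \<open>The index set \<open>\<A>\<close> may omit the empty multiset; then the constant
    term is zero on the tube domain and both claims hold trivially.\<close>
  have empty: "holo_on tube_scale tube (c {#})" "\<And>\<zeta> p. (\<zeta>, p) \<in> tube \<Longrightarrow> c {#} (\<zeta> + 1, p) = c {#} (\<zeta>, p)"
  proof -
    show "holo_on tube_scale tube (c {#})"
    proof (cases "{#} \<in> \<A>")
      case False
      have "holo_on tube_scale tube (\<lambda>_ :: 'a tube_pt. 0)"
        unfolding holo_on_def by (auto intro!: exI[of _ "\<lambda>_. 0"])
      then show ?thesis by (rule holo_on_cong[OF _ open_tube]) (simp add: c0[OF False])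
    qed (use c in blast)
    show "c {#} (\<zeta> + 1, p) = c {#} (\<zeta>, p)" if "(\<zeta>, p) \<in> tube" for \<zeta> p
      using per[OF _ that] c0[of "{#}" "(\<zeta>, p)"] c0[of "{#}" "(\<zeta> + 1, p)"] that
      by (cases "{#} \<in> \<A>") (auto simp: tube_iff)
  qed
  show ?thesis
  proof (intro exI conjI allI)
    show "\<forall>(\<tau>', z, \<tau>) \<in> tube. ((\<lambda>m. e_exp (of_int m * \<tau>') * fcoef m (c {#}) (z, \<tau>)) has_sum f (\<tau>', z, \<tau>)) UNIV"
      using fcoef_has_sum[OF empty] f by auto
    fix m
    have "slash k m g (limit_coeff m c \<A> 0) p = limit_coeff m c \<A> 0 p"
      if "g \<in> inter_jacobi r \<Gamma>" "p \<in> jacobi_domain" for g p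
    proof -
      have "g \<in> carrier jacobi_group" "jacobi_embed r g \<in> \<Gamma>" using that by (auto simp: inter_jacobi_def)
      then show ?thesis
        using \<Gamma> that(2) by (intro slash_limit_coeff[OF r c per F fin]) (auto simp: O_plus_R_def inv)
    qed
    moreover have "poly_expansion jac_scale jacobi_domain (insert None (Some ` B)) (jacobi_var B)
        (boundary_coeff m c) (limit_coeff m c \<A> 0)"
      by (rule poly_expansion_limit_coeff[OF c c0 per fin])
    \<comment> \<open>In degree 0 the power of \<open>- \<i> / 2\<close> is 1, so the constant term
      of the limit is the Fourier coefficient of \<open>f\<close> itself.\<close>
    moreover have "fcoef m (c {#}) p = boundary_coeff m c {#} p" for p
      by (simp add: boundary_coeff_def)
    ultimately show "weak_quasi_jacobi B k m (inter_jacobi r \<Gamma>) (fcoef m (c {#}))"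
      unfolding weak_quasi_jacobi_def weak_almost_holo_jacobi_def by blast
  qed
qed

end
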